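(* Let $\lambda$ be a regular uncountable cardinal. Then over every field there exists a $\lambda^+$-Gross space of dimension $\lambda^+$.
   Context: For an infinite cardinal $\mu$, a $\mu$-Gross space over a field $F$ is an $F$-vector space $E$ with a symmetric bilinear form $\Phi:E\times E\to F$ such that every subspace $U\subseteq E$ with $\dim U\ge\mu$ satisfies $\dim U^\perp<\dim E$, where $U^\perp=\{x\in E:\Phi(x,y)=0\ \forall y\in U\}$. $\lambda^+$ is the cardinal successor of $\lambda$. *)

theory Defs
  imports "HOL.Vector_Spaces" "HOL-Library.Function_Algebras"
begin

unbundle cardinal_syntax

context vector_space
begin

text \<open>The library function \<open>dim\<close> is natural-number valued and useless for infinite dimensions;
  \<open>cdim\<close> is its cardinal-valued counterpart. Arguments are meant to be subspaces, and the
  choice of the basis is irrelevant up to \<open>=o\<close> by \<open>card_of_basis_ordIso_cdim\<close> below.\<close>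

definition cdim :: "'b set \<Rightarrow> 'b rel"
  where "cdim U = |SOME B. independent B \<and> span B = span U|"

lemma card_of_basis_ordIso_cdim:
  assumes "independent B" and "span B = span U"
  shows "|B| =o cdim U"
proof -
  let ?C = "SOME B. independent B \<and> span B = span U"
  have "independent ?C \<and> span ?C = span U"
    using assms by (rule_tac someI[of _ B]) blast
  then have "\<exists>f. bij_betw f B ?C"
    using assms by (intro bij_if_span_eq_span_bases) auto
  then show ?thesis
    unfolding cdim_def by (simp add: card_of_ordIso)
qed

definition symmetric_bilinear_form_on :: "'b set \<Rightarrow> ('b \<Rightarrow> 'b \<Rightarrow> 'a) \<Rightarrow> bool"
  where "symmetric_bilinear_form_on E \<Phi> \<longleftrightarrow>
    (\<forall>x\<in>E. \<forall>y\<in>E. \<Phi> x y = \<Phi> y x) \<and>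
    (\<forall>x\<in>E. \<forall>y\<in>E. \<forall>z\<in>E. \<Phi> (x + y) z = \<Phi> x z + \<Phi> y z) \<and>
    (\<forall>x\<in>E. \<forall>y\<in>E. \<forall>z\<in>E. \<Phi> x (y + z) = \<Phi> x y + \<Phi> x z) \<and>
    (\<forall>c. \<forall>x\<in>E. \<forall>y\<in>E. \<Phi> (scale c x) y = c * \<Phi> x y) \<and>
    (\<forall>c. \<forall>x\<in>E. \<forall>y\<in>E. \<Phi> x (scale c y) = c * \<Phi> x y)"

end

definition orthogonal_space :: "'b set \<Rightarrow> ('b \<Rightarrow> 'b \<Rightarrow> 'a::zero) \<Rightarrow> 'b set \<Rightarrow> 'b set"
  where "orthogonal_space E \<Phi> U = {x \<in> E. \<forall>y\<in>U. \<Phi> x y = 0}"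

text \<open>The space is a subspace \<open>E\<close> of an ambient vector space given by a type, since a type of
  the desired cardinality need not be available. Only the values of \<open>\<Phi>\<close> on \<open>E\<close> matter.
  Cardinals are cardinal well-orders as in the library, here \<open>\<mu>\<close>.\<close>

locale gross_space = vector_space scale
  for scale :: "'a::field \<Rightarrow> 'b::ab_group_add \<Rightarrow> 'b" +
  fixes \<mu> :: "'m rel"
    and E :: "'b set"
    and \<Phi> :: "'b \<Rightarrow> 'b \<Rightarrow> 'a"
  assumes card_order: "Card_order \<mu>"
    and infinite: "cinfinite \<mu>"
    and subspace: "subspace E"
    and form: "symmetric_bilinear_form_on E \<Phi>"
    and gross: "\<And>U. subspace U \<Longrightarrow> U \<subseteq> E \<Longrightarrow> \<mu> \<le>o cdim U \<Longrightarrow>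
      cdim (orthogonal_space E \<Phi> U) <o cdim E"

end

theory Submission
  imports Defs "HOL-Library.Nat_Bijection"
begin

text \<open>The form is built from a colouring \<open>p\<close> of the pairs of ordinals below \<open>\<lambda>\<^sup>+\<close>, \<open>\<lambda> = |L|\<close>, with
  \<open>\<lambda>\<close> many colours such that for any two families of \<open>\<lambda>\<^sup>+\<close> many finite sets tending to the top,
  every colour is constant on some rectangle \<open>a \<times> b\<close> with \<open>a\<close> below \<open>b\<close>. A colour
  prescribes two \<open>0\<close>-\<open>1\<close> functions of the index, given by finitely many membership tests in distinct
  subsets of \<open>\<lambda>\<close>, and the form on the basis is the product of their values. A subspace of dimension
  \<open>\<lambda>\<^sup>+\<close> contains nonzero vectors with support above any given ordinal, and \<open>\<lambda>\<^sup>+\<close> many of them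
  have a nonzero sum against the same function. Hence two such subspaces are never orthogonal.

  The colouring comes from walks on ordinals. Let \<open>d\<close> have cofinality \<open>\<lambda>\<close>. The walk from \<open>j > d\<close> to any
  \<open>i < d\<close> close enough to \<open>d\<close> passes through \<open>d\<close>, and its part above \<open>d\<close> does not depend on \<open>i\<close>.
  The colour of the pair is the label of one node of the walk, where the labels are given by \<open>\<lambda>\<close> many
  disjoint stationary sets; so \<open>d\<close> has to be recognised from the word of letters along the walk. If
  \<open>\<lambda> = \<mu>\<^sup>+\<close>, then the letters are ordinals below \<open>\<lambda>\<close>, and each new maximum \<open>z\<close> of the word that
  replaces a maximum \<open>y\<close> is valued by the image of \<open>y\<close> under an injection \<open>z \<rightarrow> \<mu>\<close>; varying the part
  of the walk above \<open>d\<close> makes the value at \<open>d\<close> the largest one. If \<open>\<lambda>\<close> is a limit cardinal, then the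
  letters are ordinals below \<open>\<omega>\<^sub>2\<close> given by another stationary partition, and the values are those of a
  colouring of \<open>\<omega>\<^sub>2\<close> obtained from the successor case with \<open>\<lambda> = \<omega>\<^sub>1\<close>.\<close>

section \<open>Stationary subsets of a successor cardinal\<close>

locale wo_set =
  fixes X :: "'i set" and lt :: "'i \<Rightarrow> 'i \<Rightarrow> bool" (infix \<open>\<prec>\<close> 50)
  assumes wf_lt: "wf {(x, y). x \<prec> y}"
    and trans: "x \<prec> y \<Longrightarrow> y \<prec> z \<Longrightarrow> x \<prec> z"
    and total: "x \<in> X \<Longrightarrow> y \<in> X \<Longrightarrow> x \<prec> y \<or> x = y \<or> y \<prec> x"
    and dom: "x \<prec> y \<Longrightarrow> x \<in> X" "x \<prec> y \<Longrightarrow> y \<in> X"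
begin

abbreviation le (infix \<open>\<preceq>\<close> 50)
  where "x \<preceq> y \<equiv> x \<prec> y \<or> x = y"

definition unbounded :: "'i set \<Rightarrow> bool"
  where "unbounded A \<longleftrightarrow> A \<subseteq> X \<and> (\<forall>x\<in>X. \<exists>a\<in>A. x \<prec> a)"

lemma irrefl: "\<not> x \<prec> x"
  using wf_lt by (auto dest: wf_irrefl)

lemma asym: "x \<prec> y \<Longrightarrow> \<not> y \<prec> x"
  using trans irrefl by blast

lemma least:
  assumes "P x"
  shows "\<exists>m. P m \<and> (\<forall>y. P y \<longrightarrow> \<not> y \<prec> m)"
proof -
  obtain m where "m \<in> {y. P y}" "\<And>y. (y, m) \<in> {(x, y). x \<prec> y} \<Longrightarrow> y \<notin> {y. P y}"
    by (rule wfE_min[OF wf_lt, of x "{y. P y}"]) (use assms in auto)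
  then show ?thesis
    by (intro exI[of _ m]) auto
qed

lemma le_lt: "x \<preceq> y \<Longrightarrow> y \<prec> z \<Longrightarrow> x \<prec> z"
  using trans by blast

lemma lt_le: "x \<prec> y \<Longrightarrow> y \<preceq> z \<Longrightarrow> x \<prec> z"
  using trans by blast

lemma le_trans: "x \<preceq> y \<Longrightarrow> y \<preceq> z \<Longrightarrow> x \<preceq> z"
  using trans by blast

lemma fin_max:
  assumes "finite A" "A \<noteq> {}" "A \<subseteq> X"
  obtains m where "m \<in> A" "\<forall>a\<in>A. a \<preceq> m"
proof -
  have "A \<subseteq> X \<longrightarrow> (\<exists>m\<in>A. \<forall>a\<in>A. a \<preceq> m)"
    using assms(1,2)
  proof (induction rule: finite_ne_induct)
    case (singleton x)
    then show ?case by simp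
  next
    case (insert x F)
    show ?case
    proof (cases "x \<in> X \<and> F \<subseteq> X")
      case True
      with insert obtain m where m: "m \<in> F" "\<forall>a\<in>F. a \<preceq> m" by blast
      with True have "x \<preceq> m \<or> m \<preceq> x" using total by blast
      with m show ?thesis by (metis insert_iff le_trans)
    qed auto
  qed
  with assms(3) that show ?thesis by blast
qed

lemma fin_bound:
  assumes "finite A" "\<forall>a\<in>A. a \<prec> d" "\<exists>e. e \<prec> d"
  obtains m where "m \<prec> d" "\<forall>a\<in>A. a \<preceq> m"
proof (cases "A = {}")
  case True
  with assms(3) that show ?thesis by blast
next
  case False
  with assms(1,2) dom show ?thesis
    by (metis fin_max subsetI that)
qed

end

text \<open>\<open>L\<close> stands for a regular cardinal \<lambda> in its initial well-order and
  \<open>X\<close> for \<lambda>^+. Apart from the final \<lambda>, the locale is also used with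
  \<open>\<omega>\<^sub>1\<close> and \<open>\<omega>\<^sub>2\<close> in these roles, so
  \<open>L\<close> is merely infinite and regular here.\<close>

locale succ_card = wo_set X lt + L: wo_set L ltL
  for X :: "'i set" and lt (infix \<open>\<prec>\<close> 50)
    and L :: "'l set" and ltL (infix \<open>\<sqsubset>\<close> 50) +
  assumes L_seg: "l \<in> L \<Longrightarrow> |{k. k \<sqsubset> l}| <o |L|"
    and stable_L: "stable |L|"
    and infinite_L: "infinite L"
    and X_seg: "x \<in> X \<Longrightarrow> |{y. y \<prec> x}| \<le>o |L|"
    and X_bound: "A \<subseteq> X \<Longrightarrow> |A| \<le>o |L| \<Longrightarrow> \<exists>x\<in>X. \<forall>a\<in>A. a \<prec> x"
begin

lemma small_finite: "finite A \<Longrightarrow> |A| <o |L|"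
  using infinite_L by (meson card_of_Well_order card_of_ordLeq_finite not_ordLess_iff_ordLeq)

lemma small_UN: "|A| <o |L| \<Longrightarrow> (\<And>a. a \<in> A \<Longrightarrow> |F a| <o |L| ) \<Longrightarrow> |\<Union>a\<in>A. F a| <o |L|"
  using stable_UNION[OF stable_L] by blast

lemma small_image: "|A| <o |L| \<Longrightarrow> |f ` A| <o |L|"
  using card_of_image ordLeq_ordLess_trans by blast

lemma small_subset: "A \<subseteq> B \<Longrightarrow> |B| <o |L| \<Longrightarrow> |A| <o |L|"
  using card_of_mono1 ordLeq_ordLess_trans by blast

lemma small_insert: "|A| <o |L| \<Longrightarrow> |insert a A| <o |L|"
  using small_UN[of "{True, False}" "\<lambda>b. if b then A else {a}"] small_finite[of "{a}"]
    small_finite[of "{True, False}"] by (auto elim: small_subset[rotated])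

lemma le_image: "|A| \<le>o |L| \<Longrightarrow> |f ` A| \<le>o |L|"
  using card_of_image ordLeq_transitive by blast

lemma le_UN: "|A| \<le>o |L| \<Longrightarrow> (\<And>a. a \<in> A \<Longrightarrow> |F a| \<le>o |L| ) \<Longrightarrow> |\<Union>a\<in>A. F a| \<le>o |L|"
  using card_of_UNION_ordLeq_infinite[OF infinite_L] by blast

lemma le_finite: "finite A \<Longrightarrow> |A| \<le>o |L|"
  using small_finite ordLess_imp_ordLeq by blast

lemma le_Un: "|A| \<le>o |L| \<Longrightarrow> |B| \<le>o |L| \<Longrightarrow> |A \<union> B| \<le>o |L|"
proof -
  assume "|A| \<le>o |L|" "|B| \<le>o |L|"
  then have "|\<Union>b\<in>{True, False}. if b then A else B| \<le>o |L|"
    by (intro le_UN) (simp_all add: le_finite)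
  then show ?thesis
    by (simp add: Un_commute)
qed

lemma le_refl: "|L| \<le>o |L|"
  using card_of_mono1 by blast

lemma le_countable: "|A::nat set| \<le>o |L|"
  using infinite_L card_of_mono1[OF subset_UNIV] infinite_iff_card_of_nat ordLeq_transitive by blast

text \<open>Regularity: if \<open>A\<close> were cofinal, \<open>L\<close> would be a union of fewer
  than \<open>|L|\<close> closed segments, each smaller than \<open>|L|\<close>.\<close>

lemma L_bound:
  assumes "A \<subseteq> L" "|A| <o |L|"
  shows "\<exists>l\<in>L. \<forall>a\<in>A. a \<sqsubset> l"
proof (rule ccontr)
  assume "\<not> ?thesis"
  then have "L \<subseteq> (\<Union>a\<in>A. insert a {k. k \<sqsubset> a})"
    using assms(1) L.total by fastforce
  moreover have "|\<Union>a\<in>A. insert a {k. k \<sqsubset> a}| <o |L|"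
    using assms L_seg by (intro small_UN small_insert) auto
  ultimately show False
    using small_subset ordLess_irreflexive by blast
qed

lemma X_bound1: "x \<in> X \<Longrightarrow> \<exists>y\<in>X. x \<prec> y"
  using X_bound[of "{x}"] le_finite[of "{x}"] by auto

lemma X_nonempty: "X \<noteq> {}"
  using X_bound[of "{}"] le_finite[of "{}"] by auto

text \<open>If every fibre were bounded, the at most \<open>|L|\<close> many bounds would have a
  common bound in \<open>X\<close>, yet \<open>A\<close> has elements above it.\<close>

lemma X_pigeonhole:
  assumes A: "unbounded A" and "|F ` A| \<le>o |L|"
  obtains y where "unbounded {x\<in>A. F x = y}"
proof -
  have "\<exists>y\<in>F ` A. unbounded {x\<in>A. F x = y}"
  proof (rule ccontr)
    assume "\<not> ?thesis"
    then have "\<forall>y\<in>F ` A. \<exists>z\<in>X. \<forall>x\<in>A. F x = y \<longrightarrow> \<not> z \<prec> x"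
      using A unfolding unbounded_def by blast
    then obtain z where z: "\<And>y. y \<in> F ` A \<Longrightarrow> z y \<in> X"
      "\<And>y x. y \<in> F ` A \<Longrightarrow> x \<in> A \<Longrightarrow> F x = y \<Longrightarrow> \<not> z y \<prec> x"
      by metis
    obtain u where u: "u \<in> X" "\<forall>y\<in>F ` A. z y \<prec> u"
      using X_bound[of "z ` F ` A"] z(1) le_image[OF assms(2), of z] by auto
    obtain a where a: "a \<in> A" "u \<prec> a"
      using A u(1) unfolding unbounded_def by blast
    show False
      using z(2)[of "F a" a] a u trans by blast
  qed
  with that show ?thesis by blast
qed

lemma L_pigeonhole:
  assumes A: "L.unbounded A" and "|F ` A| <o |L|"
  obtains y where "L.unbounded {x\<in>A. F x = y}"
proof -
  have "\<exists>y\<in>F ` A. L.unbounded {x\<in>A. F x = y}"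
  proof (rule ccontr)
    assume "\<not> ?thesis"
    then have "\<forall>y\<in>F ` A. \<exists>z\<in>L. \<forall>x\<in>A. F x = y \<longrightarrow> \<not> z \<sqsubset> x"
      using A unfolding L.unbounded_def by blast
    then obtain z where z: "\<And>y. y \<in> F ` A \<Longrightarrow> z y \<in> L"
      "\<And>y x. y \<in> F ` A \<Longrightarrow> x \<in> A \<Longrightarrow> F x = y \<Longrightarrow> \<not> z y \<sqsubset> x"
      by metis
    obtain u where u: "u \<in> L" "\<forall>y\<in>F ` A. z y \<sqsubset> u"
      using L_bound[of "z ` F ` A"] z(1) small_image[OF assms(2), of z] by auto
    obtain a where a: "a \<in> A" "u \<sqsubset> a"
      using A u(1) unfolding L.unbounded_def by blast
    show False
      using z(2)[of "F a" a] a u L.trans by blast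
  qed
  with that show ?thesis by blast
qed

lemma X_unbounded: "unbounded X"
  using X_bound1 unfolding unbounded_def by blast

lemma L_bound1: "l \<in> L \<Longrightarrow> \<exists>k\<in>L. l \<sqsubset> k"
  using L_bound[of "{l}"] small_finite[of "{l}"] by auto

lemma L_unbounded: "L.unbounded L"
  using L_bound1 unfolding L.unbounded_def by blast

lemma unbounded_large: "unbounded A \<Longrightarrow> |L| <o |A|"
proof (rule ccontr)
  assume A: "unbounded A" "\<not> |L| <o |A|"
  then have "|A| \<le>o |L|"
    by (meson card_of_Well_order not_ordLess_iff_ordLeq)
  with A(1) obtain x where "x \<in> X" "\<forall>a\<in>A. a \<prec> x"
    using X_bound[of A] unfolding unbounded_def by metis
  with A(1) asym show False
    unfolding unbounded_def by blast
qed

section \<open>Closure points, stationary sets and points of cofinality \<lambda>\<close>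

definition club_pt :: "('i \<Rightarrow> 'i) \<Rightarrow> 'i \<Rightarrow> bool"
  where "club_pt g d \<longleftrightarrow> (\<forall>x. x \<prec> d \<longrightarrow> g x \<prec> d)"

text \<open>Closure points of functions replace club sets. The least point is vacuously a closure
  point of every function, so this is the usual notion only for sets that avoid it, such as subsets
  of \<open>E\<close>.\<close>

definition stationary :: "'i set \<Rightarrow> bool"
  where "stationary S \<longleftrightarrow> (\<forall>g. (\<forall>x\<in>X. g x \<in> X) \<longrightarrow> (\<exists>d\<in>S. club_pt g d))"

text \<open>The points of cofinality \<open>|L|\<close>.\<close>

definition E :: "'i set"
  where "E = {d\<in>X. \<forall>B. B \<subseteq> {y. y \<prec> d} \<and> |B| <o |L| \<longrightarrow> (\<exists>y. y \<prec> d \<and> (\<forall>b\<in>B. b \<prec> y))}"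

lemma E_bound:
  assumes "d \<in> E" "|I| <o |L|" "\<And>i. i \<in> I \<Longrightarrow> F i \<prec> d"
  obtains y where "y \<prec> d" "\<forall>i\<in>I. F i \<prec> y"
proof -
  have "F ` I \<subseteq> {y. y \<prec> d}" "|F ` I| <o |L|"
    using assms small_image by auto
  then show ?thesis
    using assms(1) that unfolding E_def mem_Collect_eq by (metis image_eqI)
qed

lemma E_X: "d \<in> E \<Longrightarrow> d \<in> X"
  unfolding E_def by blast

lemma E_pred: "d \<in> E \<Longrightarrow> \<exists>y. y \<prec> d"
  using E_bound[of d "{}" "\<lambda>x. x"] small_finite by (metis empty_iff finite.emptyI)

lemma stationary_mono: "stationary S \<Longrightarrow> S \<subseteq> T \<Longrightarrow> stationary T"
  unfolding stationary_def by blast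

text \<open>Enlarge \<open>g\<close> so that all its values exceed \<open>x\<close>; a closure point
  with a predecessor then lies above \<open>x\<close>, and points of \<open>E\<close> have
  predecessors.\<close>

lemma stationaryD:
  assumes S: "stationary S" "S \<subseteq> E" and g: "\<forall>x\<in>X. g x \<in> X" and x: "x \<in> X"
  obtains d where "d \<in> S" "club_pt g d" "x \<prec> d"
proof -
  have "\<forall>y\<in>X. \<exists>z\<in>X. g y \<prec> z \<and> x \<prec> z"
  proof
    fix y assume "y \<in> X"
    with g x show "\<exists>z\<in>X. g y \<prec> z \<and> x \<prec> z"
      using X_bound[of "{g y, x}"] le_finite[of "{g y, x}"] by auto
  qed
  then obtain g' where g': "\<And>y. y \<in> X \<Longrightarrow> g' y \<in> X \<and> g y \<prec> g' y \<and> x \<prec> g' y"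
    by metis
  then obtain d where d: "d \<in> S" "club_pt g' d"
    using S(1) unfolding stationary_def by blast
  obtain y where "y \<prec> d"
    using d(1) S(2) E_pred by blast
  then have "x \<prec> d"
    using d(2) g' trans dom unfolding club_pt_def by blast
  moreover have "club_pt g d"
    using d(2) g' trans dom unfolding club_pt_def by blast
  ultimately show ?thesis
    using that d by blast
qed

text \<open>Pressing down, with a bound in place of a constant value. If for every \<open>x\<close>
  some \<open>g x\<close> bounded the \<open>d\<close> with \<open>e d \<preceq> x\<close>, then a
  closure point \<open>d\<close> of \<open>g\<close> in \<open>S\<close> would satisfy
  \<open>g (e d) \<prec> d\<close>, a contradiction at \<open>x = e d\<close>.\<close>

lemma Fodor:
  assumes "stationary S" and "\<And>d. d \<in> S \<Longrightarrow> e d \<prec> d"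
  obtains x where "x \<in> X" "\<And>y. y \<in> X \<Longrightarrow> \<exists>d\<in>S. y \<prec> d \<and> e d \<preceq> x"
proof -
  have "\<exists>x\<in>X. \<forall>y\<in>X. \<exists>d\<in>S. y \<prec> d \<and> e d \<preceq> x"
  proof (rule ccontr)
    assume "\<not> ?thesis"
    then obtain g where g: "\<And>x. x \<in> X \<Longrightarrow> g x \<in> X \<and> (\<forall>d\<in>S. g x \<prec> d \<longrightarrow> \<not> e d \<preceq> x)"
      by metis
    then obtain d where "d \<in> S" "club_pt g d"
      using assms(1) unfolding stationary_def by blast
    with assms(2) g dom show False
      unfolding club_pt_def by blast
  qed
  with that show ?thesis by blast
qed

text \<open>If each piece missed the closure points of its own \<open>g k\<close>, a single
  \<open>g'\<close> above all \<open>g k\<close> would have no closure point in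
  \<open>S\<close>.\<close>

lemma stationary_partition:
  assumes S: "stationary S" "S \<subseteq> E" "S \<subseteq> (\<Union>k\<in>K. T k)" and "|K| \<le>o |L|"
  obtains k where "k \<in> K" "stationary (S \<inter> T k)"
proof -
  have "\<exists>k\<in>K. stationary (S \<inter> T k)"
  proof (rule ccontr)
    assume "\<not> ?thesis"
    then have "\<forall>k\<in>K. \<exists>g. (\<forall>x\<in>X. g x \<in> X) \<and> (\<forall>d\<in>S \<inter> T k. \<not> club_pt g d)"
      unfolding stationary_def by blast
    then obtain g where g: "\<And>k x. k \<in> K \<Longrightarrow> x \<in> X \<Longrightarrow> g k x \<in> X"
      "\<And>k d. k \<in> K \<Longrightarrow> d \<in> S \<inter> T k \<Longrightarrow> \<not> club_pt (g k) d"
      by metis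
    have "\<forall>x\<in>X. \<exists>y\<in>X. \<forall>k\<in>K. g k x \<prec> y"
      using X_bound[OF _ le_image[OF assms(4), of "\<lambda>k. g k _"]] g(1) by fastforce
    then obtain g' where g': "\<And>x. x \<in> X \<Longrightarrow> g' x \<in> X \<and> (\<forall>k\<in>K. g k x \<prec> g' x)"
      by metis
    then obtain d where d: "d \<in> S" "club_pt g' d"
      using S(1) unfolding stationary_def by blast
    with S(3) obtain k where k: "k \<in> K" "d \<in> T k"
      by blast
    have "club_pt (g k) d"
      using d(2) g' k trans dom unfolding club_pt_def by blast
    with g(2) d k show False
      by blast
  qed
  with that show ?thesis by blast
qed

text \<open>Iterate \<omega> times a function that dominates \<open>g\<close> on closed initial
  segments. Everything below the supremum lies below some iterate, so its \<open>g\<close>-value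
  stays below the next one.\<close>

lemma club_unbounded:
  assumes g: "\<forall>x\<in>X. g x \<in> X" and x: "x \<in> X"
  obtains d where "x \<prec> d" "club_pt g d"
proof -
  have "\<exists>z\<in>X. y \<prec> z \<and> (\<forall>u. u \<preceq> y \<longrightarrow> g u \<prec> z)" if y: "y \<in> X" for y
  proof -
    have "|insert y (g ` (insert y {u. u \<prec> y}))| \<le>o |L|"
      using le_Un[OF le_finite[of "{y, g y}"] le_image[OF X_seg[OF y], of g]]
      by (simp add: insert_commute)
    moreover have "insert y (g ` (insert y {u. u \<prec> y})) \<subseteq> X"
      using y g by (auto dest: dom)
    ultimately obtain z where "z \<in> X" "\<forall>a\<in>insert y (g ` (insert y {u. u \<prec> y})). a \<prec> z"
      using X_bound by metis
    then show ?thesis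
      by blast
  qed
  then obtain s where s: "\<And>y. y \<in> X \<Longrightarrow> s y \<in> X \<and> y \<prec> s y \<and> (\<forall>u. u \<preceq> y \<longrightarrow> g u \<prec> s y)"
    by metis
  define t where "t n = (s ^^ n) x" for n
  have t: "t n \<in> X" "t n \<prec> t (Suc n)" "u \<preceq> t n \<Longrightarrow> g u \<prec> t (Suc n)" for n u
  proof -
    show "t n \<in> X" by (induction n) (auto simp: t_def x s)
    then show "t n \<prec> t (Suc n)" "u \<preceq> t n \<Longrightarrow> g u \<prec> t (Suc n)"
      using s[of "t n"] by (auto simp: t_def)
  qed
  have "\<exists>d\<in>X. \<forall>n. t n \<prec> d"
    using X_bound[of "range t"] t(1) le_image[OF le_countable, of t UNIV] by auto
  then obtain d' where d': "d' \<in> X \<and> (\<forall>n. t n \<prec> d')"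
    by blast
  obtain d where d: "d \<in> X \<and> (\<forall>n. t n \<prec> d)"
    "\<And>y. y \<in> X \<and> (\<forall>n. t n \<prec> y) \<Longrightarrow> \<not> y \<prec> d"
    using least[of "\<lambda>d. d \<in> X \<and> (\<forall>n. t n \<prec> d)", OF d'] by blast
  have "club_pt g d"
    unfolding club_pt_def
  proof (intro allI impI)
    fix u assume u: "u \<prec> d"
    with d(2) have "\<not> (u \<in> X \<and> (\<forall>n. t n \<prec> u))" by blast
    with u obtain n where "u \<preceq> t n"
      using dom t(1) total by blast
    with t(3) d(1) trans[of "g u" "t (Suc n)" d] show "g u \<prec> d" by blast
  qed
  moreover have "x \<prec> d"
    using d(1)[THEN conjunct2, rule_format, of 0] by (simp add: t_def)
  ultimately show ?thesis
    using that by blast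
qed

text \<open>The least \<open>d\<close> with \<open>|L|\<close> many closure points below it has cofinality \<open>|L|\<close>.\<close>

lemma stationary_E: "stationary E"
  unfolding stationary_def
proof (intro allI impI)
  fix g assume g: "\<forall>x\<in>X. g x \<in> X"
  define D where "D = {d\<in>X. club_pt g d}"
  have "\<exists>d\<in>D. x \<prec> d" if "x \<in> X" for x
    using club_unbounded[OF g that] dom(2) unfolding D_def by (metis (no_types, lifting) mem_Collect_eq)
  then have "unbounded D"
    unfolding unbounded_def D_def by blast
  then have "|L| \<le>o |D|"
    using unbounded_large ordLess_imp_ordLeq by blast
  then obtain h where h: "inj_on h L" "h ` L \<subseteq> D"
    using card_of_ordLeq by metis
  have "|h ` L| \<le>o |L|" by (rule card_of_image)
  then obtain x where "x \<in> X" "\<forall>y\<in>h ` L. y \<prec> x"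
    using X_bound[of "h ` L"] h(2) unfolding D_def by blast
  then have "h ` L \<subseteq> {y\<in>D. y \<prec> x}"
    using h(2) by blast
  then have "|h ` L| \<le>o |{y\<in>D. y \<prec> x}|"
    by (rule card_of_mono1)
  moreover have "|h ` L| =o |L|"
    using h(1) by (meson bij_betw_imageI card_of_ordIsoI ordIso_symmetric)
  ultimately have "|L| \<le>o |{y\<in>D. y \<prec> x}|"
    using ordIso_ordLeq_trans ordIso_symmetric by blast
  then have "\<not> |{y\<in>D. y \<prec> x}| <o |L|"
    using not_ordLess_ordLeq by blast
  then have x: "x \<in> X \<and> \<not> |{y\<in>D. y \<prec> x}| <o |L|"
    using \<open>x \<in> X\<close> by blast
  obtain d where d0: "d \<in> X \<and> \<not> |{y\<in>D. y \<prec> d}| <o |L|"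
    and "\<And>y. y \<in> X \<and> \<not> |{z\<in>D. z \<prec> y}| <o |L| \<Longrightarrow> \<not> y \<prec> d"
    using least[of "\<lambda>x. x \<in> X \<and> \<not> |{y\<in>D. y \<prec> x}| <o |L|", OF x] by blast
  then have d: "d \<in> X" "\<not> |{y\<in>D. y \<prec> d}| <o |L|"
    and min: "\<And>y. y \<in> X \<Longrightarrow> y \<prec> d \<Longrightarrow> |{z\<in>D. z \<prec> y}| <o |L|"
    by blast+
  have le: "|{z\<in>D. z \<preceq> y}| <o |L|" if "y \<prec> d" for y
  proof -
    have "{z\<in>D. z \<preceq> y} \<subseteq> insert y {z\<in>D. z \<prec> y}" by blast
    then show ?thesis
      using min[of y] that dom small_insert small_subset by meson
  qed
  \<comment> \<open>Otherwise all closure points below \<open>d\<close> lie at or below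
    \<open>y\<close>, and minimality of \<open>d\<close> makes them too few.\<close>
  have above: "\<exists>z\<in>D. y \<prec> z \<and> z \<prec> d" if y: "y \<prec> d" for y
  proof (rule ccontr)
    assume "\<not> ?thesis"
    then have "{z\<in>D. z \<prec> d} \<subseteq> {z\<in>D. z \<preceq> y}"
      using y dom total unfolding D_def by blast
    with le[OF y] d(2) small_subset show False by blast
  qed
  have "d \<in> E"
    unfolding E_def
  proof (intro CollectI conjI allI impI d(1), elim conjE)
    fix B assume B: "B \<subseteq> {y. y \<prec> d}" "|B| <o |L|"
    show "\<exists>y. y \<prec> d \<and> (\<forall>b\<in>B. b \<prec> y)"
    \<comment> \<open>If \<open>B\<close> were cofinal below \<open>d\<close>, the closure points
      below \<open>d\<close> would form a union of fewer than \<open>|L|\<close> sets smaller than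
      \<open>|L|\<close>.\<close>
    proof (rule ccontr)
      assume "\<not> ?thesis"
      then have "\<exists>b\<in>B. \<not> b \<prec> z" if "z \<prec> d" for z
        using that by blast
      moreover have "b \<in> X" if "b \<in> B" for b
        using that B(1) dom(1)[of b d] by auto
      ultimately have "\<exists>b\<in>B. z \<preceq> b" if "z \<prec> d" for z
        using that dom(1)[OF that] total[of z] by metis
      then have "{z\<in>D. z \<prec> d} \<subseteq> (\<Union>b\<in>B. {z\<in>D. z \<preceq> b})"
        by fastforce
      moreover have "|\<Union>b\<in>B. {z\<in>D. z \<preceq> b}| <o |L|"
        using B le by (intro small_UN) auto
      ultimately show False
        using d(2) small_subset by blast
    qed
  qed
  moreover have "club_pt g d"
    unfolding club_pt_def
  proof (intro allI impI)
    fix x assume "x \<prec> d"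
    then obtain z where "z \<in> D" "x \<prec> z" "z \<prec> d"
      using above by blast
    then show "g x \<prec> d"
      unfolding D_def club_pt_def using trans[of "g x" z d] by blast
  qed
  ultimately show "\<exists>d\<in>E. club_pt g d" by blast
qed

definition emb :: "'i \<Rightarrow> 'i \<Rightarrow> 'l"
  where "emb t = (SOME f. inj_on f {y. y \<prec> t} \<and> f ` {y. y \<prec> t} \<subseteq> L)"

lemma emb:
  assumes "t \<in> X"
  shows "inj_on (emb t) {y. y \<prec> t}" "y \<prec> t \<Longrightarrow> emb t y \<in> L"
proof -
  have "\<exists>f. inj_on f {y. y \<prec> t} \<and> f ` {y. y \<prec> t} \<subseteq> L"
    using X_seg[OF assms] card_of_ordLeq by metis
  from someI_ex[OF this] show "inj_on (emb t) {y. y \<prec> t}" "y \<prec> t \<Longrightarrow> emb t y \<in> L"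
    unfolding emb_def by auto
qed

text \<open>An Ulam matrix splits \<open>E\<close> into disjoint stationary sets.\<close>

lemma stationary_family:
  assumes "|K| \<le>o |L|"
  obtains S where "\<And>k. k \<in> K \<Longrightarrow> stationary (S k)" "\<And>k. k \<in> K \<Longrightarrow> S k \<subseteq> E"
    "\<And>k k'. k \<in> K \<Longrightarrow> k' \<in> K \<Longrightarrow> k \<noteq> k' \<Longrightarrow> S k \<inter> S k' = {}"
proof -
  \<comment> \<open>Row \<open>x\<close> and column \<open>l\<close> of the matrix. Each row covers
    the part of \<open>E\<close> above \<open>x\<close>; within a column the rows are disjoint
    because \<open>emb d\<close> is injective.\<close>
  define A where "A x l = {d\<in>E. x \<prec> d \<and> emb d x = l}" for x l
  have "\<exists>l\<in>L. stationary (A x l)" if x: "x \<in> X" for x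
  proof -
    have "stationary {d\<in>E. x \<prec> d}"
      unfolding stationary_def
      using stationaryD[OF stationary_E order.refl _ x] by blast
    moreover have "{d\<in>E. x \<prec> d} \<subseteq> (\<Union>l\<in>L. A x l)"
      using emb E_X unfolding A_def by auto
    ultimately obtain l where "l \<in> L" "stationary ({d\<in>E. x \<prec> d} \<inter> A x l)"
      using stationary_partition[of "{d\<in>E. x \<prec> d}" "A x" L] le_refl by blast
    then show ?thesis
      using stationary_mono by blast
  qed
  then obtain F where F: "\<And>x. x \<in> X \<Longrightarrow> F x \<in> L \<and> stationary (A x (F x))"
    by metis
  then have "F ` X \<subseteq> L" by blast
  then have "|F ` X| \<le>o |L|" by (rule card_of_mono1)
  \<comment> \<open>One column is chosen by unboundedly many rows, hence by enough of them to index
    \<open>K\<close>.\<close>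
  then obtain l where l: "unbounded {x\<in>X. F x = l}"
    using X_pigeonhole[OF X_unbounded] by blast
  then have "|K| \<le>o |{x\<in>X. F x = l}|"
    using unbounded_large assms ordLess_imp_ordLeq ordLeq_transitive by blast
  then obtain h where h: "inj_on h K" "h ` K \<subseteq> {x\<in>X. F x = l}"
    using card_of_ordLeq[of K "{x\<in>X. F x = l}"] by blast
  show ?thesis
  proof (rule that[of "\<lambda>k. A (h k) l"])
    show "stationary (A (h k) l)" if "k \<in> K" for k
    proof -
      from h(2) that have "h k \<in> X" "F (h k) = l" by auto
      with F[of "h k"] show ?thesis by simp
    qed
    show "A (h k) l \<inter> A (h k') l = {}" if "k \<in> K" "k' \<in> K" "k \<noteq> k'" for k k'
    proof (rule ccontr)
      assume "A (h k) l \<inter> A (h k') l \<noteq> {}"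
      then obtain d where "d \<in> A (h k) l" "d \<in> A (h k') l"
        by blast
      then have "d \<in> E" "h k \<prec> d" "h k' \<prec> d" "emb d (h k) = emb d (h k')"
        unfolding A_def by simp_all
      then have "h k = h k'"
        using emb(1)[OF E_X] unfolding inj_on_def by blast
      with h that show False
        unfolding inj_on_def by blast
    qed
  qed (auto simp: A_def)
qed

end

section \<open>Walks\<close>

text \<open>Every letter of a word that exceeds all earlier letters makes a claim; the strictly largest claim
  determines a position in the word, up to a left shift \<open>off\<close> that is encoded in the claim itself.\<close>

primrec claims_from :: "('n \<Rightarrow> 'n \<Rightarrow> bool) \<Rightarrow> ('n \<Rightarrow> 'n \<Rightarrow> 'c) \<Rightarrow> 'n \<Rightarrow> 'n list \<Rightarrow> 'c option list"
  where
    "claims_from lt ob m [] = []"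
  | "claims_from lt ob m (y # ys) =
      (if lt m y then Some (ob m y) # claims_from lt ob y ys else None # claims_from lt ob m ys)"

primrec run_max :: "('n \<Rightarrow> 'n \<Rightarrow> bool) \<Rightarrow> 'n \<Rightarrow> 'n list \<Rightarrow> 'n"
  where
    "run_max lt m [] = m"
  | "run_max lt m (y # ys) = run_max lt (if lt m y then y else m) ys"

text \<open>The first letter has no earlier maximum to replace, hence claims nothing.\<close>

definition claims :: "('n \<Rightarrow> 'n \<Rightarrow> bool) \<Rightarrow> ('n \<Rightarrow> 'n \<Rightarrow> 'c) \<Rightarrow> 'n list \<Rightarrow> 'c option list"
  where "claims lt ob w = (case w of [] \<Rightarrow> [] | x # xs \<Rightarrow> None # claims_from lt ob x xs)"

definition word_max :: "('n \<Rightarrow> 'n \<Rightarrow> bool) \<Rightarrow> 'n list \<Rightarrow> 'n"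
  where "word_max lt w = run_max lt (hd w) (tl w)"

definition split_pos ::
    "('n \<Rightarrow> 'n \<Rightarrow> bool) \<Rightarrow> ('n \<Rightarrow> 'n \<Rightarrow> 'c) \<Rightarrow> ('c \<Rightarrow> 'c \<Rightarrow> bool) \<Rightarrow> ('c \<Rightarrow> nat) \<Rightarrow> 'n list \<Rightarrow> nat"
  where "split_pos lt ob lc off w = (THE n. \<exists>k c. k < length (claims lt ob w) \<and>
    claims lt ob w ! k = Some c \<and> n = k - off c \<and>
    (\<forall>k'<length (claims lt ob w). k' \<noteq> k \<longrightarrow> (\<forall>c'. claims lt ob w ! k' = Some c' \<longrightarrow> lc c' c)))"

lemma claims_from_append:
  "claims_from lt ob m (xs @ ys) = claims_from lt ob m xs @ claims_from lt ob (run_max lt m xs) ys"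
  by (induction xs arbitrary: m) auto

lemma length_claims_from [simp]: "length (claims_from lt ob m xs) = length xs"
  by (induction xs arbitrary: m) auto

lemma claims_append:
  "r \<noteq> [] \<Longrightarrow> claims lt ob (r @ s) = claims lt ob r @ claims_from lt ob (word_max lt r) s"
  by (cases r) (auto simp: claims_def word_max_def claims_from_append)

lemma length_claims [simp]: "length (claims lt ob w) = length w"
  by (auto simp: claims_def split: list.split)

lemma claims_from_const:
  "\<forall>y\<in>set s. \<not> lt m y \<Longrightarrow> claims_from lt ob m s = replicate (length s) None \<and> run_max lt m s = m"
  by (induction s) auto

text \<open>The letters of \<open>s\<close> are no new maxima and claim nothing, so the claim of
  \<open>q\<close> sits at position \<open>length r + length s\<close>. It beats all claims from
  \<open>r\<close> and \<open>u\<close>, and the shift \<open>length s\<close> leads back to the end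
  of \<open>r\<close>.\<close>

lemma split_pos_eq:
  assumes asym: "\<And>c c'. lc c c' \<Longrightarrow> \<not> lc c' c"
    and r: "r \<noteq> []" and s: "\<forall>y\<in>set s. \<not> lt (word_max lt r) y" and q: "lt (word_max lt r) q"
    and off: "off (ob (word_max lt r) q) = length s"
    and cr: "\<And>c. Some c \<in> set (claims lt ob r) \<Longrightarrow> lc c (ob (word_max lt r) q)"
    and cu: "\<And>c. Some c \<in> set (claims_from lt ob q u) \<Longrightarrow> lc c (ob (word_max lt r) q)"
  shows "split_pos lt ob lc off (r @ s @ q # u) = length r"
proof -
  let ?w = "r @ s @ q # u" and ?M = "word_max lt r"
  define k where "k = length r + length s"
  define c where "c = ob ?M q"
  have w: "claims lt ob ?w = claims lt ob r @ replicate (length s) None @ Some c # claims_from lt ob q u"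
    using r q claims_from_const[where lt = lt and ob = ob, OF s] by (simp add: claims_append claims_from_append c_def)
  have k: "k < length (claims lt ob ?w)" "claims lt ob ?w ! k = Some c"
    unfolding w by (simp_all add: k_def nth_append)
  have other: "lc c' c" if *: "k' < length (claims lt ob ?w)" "k' \<noteq> k" "claims lt ob ?w ! k' = Some c'" for k' c'
  proof -
    consider "k' < length r" | "length r \<le> k'" "k' < k" | "k < k'"
      using *(2) by linarith
    then show ?thesis
    proof cases
      case 1
      then have "Some c' \<in> set (claims lt ob r)"
        using *(3) unfolding w by (metis length_claims nth_append nth_mem)
      then show ?thesis using cr c_def by simp
    next
      case 2
      then have "claims lt ob ?w ! k' = None"
        unfolding w k_def by (simp add: nth_append)
      then show ?thesis using *(3) by simp
    next
      case 3
      then obtain n where n: "k' = k + Suc n" using less_iff_Suc_add by auto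
      then have "claims_from lt ob q u ! n = Some c'" "n < length u"
        using *(1,3) unfolding w k_def by (auto simp: nth_append)
      then have "Some c' \<in> set (claims_from lt ob q u)"
        by (metis length_claims_from nth_mem)
      then show ?thesis using cu c_def by simp
    qed
  qed
  show ?thesis
    unfolding split_pos_def
  proof (rule the_equality)
    show "\<exists>k c. k < length (claims lt ob ?w) \<and> claims lt ob ?w ! k = Some c \<and> length r = k - off c \<and>
      (\<forall>k'<length (claims lt ob ?w). k' \<noteq> k \<longrightarrow> (\<forall>c'. claims lt ob ?w ! k' = Some c' \<longrightarrow> lc c' c))"
      using k other off by (intro exI[of _ k] exI[of _ c]) (auto simp: k_def c_def)
  next
    fix n assume "\<exists>k c. k < length (claims lt ob ?w) \<and> claims lt ob ?w ! k = Some c \<and> n = k - off c \<and>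
      (\<forall>k'<length (claims lt ob ?w). k' \<noteq> k \<longrightarrow> (\<forall>c'. claims lt ob ?w ! k' = Some c' \<longrightarrow> lc c' c))"
    then obtain k1 c1 where 1: "k1 < length (claims lt ob ?w)" "claims lt ob ?w ! k1 = Some c1" "n = k1 - off c1"
      "\<forall>k'<length (claims lt ob ?w). k' \<noteq> k1 \<longrightarrow> (\<forall>c'. claims lt ob ?w ! k' = Some c' \<longrightarrow> lc c' c1)"
      by blast
    have "k1 = k"
      using 1 k other asym by metis
    then show "n = length r"
      using 1 k off by (simp add: k_def c_def)
  qed
qed

context wo_set
begin

lemma run_max:
  assumes "m \<in> X" "set xs \<subseteq> X"
  shows "run_max lt m xs \<in> insert m (set xs)" "\<forall>y\<in>insert m (set xs). y \<preceq> run_max lt m xs"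
proof -
  have "run_max lt m xs \<in> insert m (set xs) \<and> (\<forall>y\<in>insert m (set xs). y \<preceq> run_max lt m xs)"
    using assms
  proof (induction xs arbitrary: m)
    case (Cons x xs)
    let ?m = "if m \<prec> x then x else m"
    from Cons have IH: "run_max lt ?m xs \<in> insert ?m (set xs)"
      "\<forall>y\<in>insert ?m (set xs). y \<preceq> run_max lt ?m xs"
      by simp_all
    have "m \<preceq> ?m" "x \<preceq> ?m"
      using Cons.prems total by auto
    then have "m \<preceq> run_max lt ?m xs" "x \<preceq> run_max lt ?m xs"
      using IH(2) le_trans by blast+
    then show ?case
      using IH by (auto split: if_splits)
  qed simp
  then show "run_max lt m xs \<in> insert m (set xs)" "\<forall>y\<in>insert m (set xs). y \<preceq> run_max lt m xs"
    by blast+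
qed

lemma word_max:
  assumes "w \<noteq> []" "set w \<subseteq> X"
  shows "word_max lt w \<in> set w" "\<forall>y\<in>set w. y \<preceq> word_max lt w"
proof -
  have "insert (hd w) (set (tl w)) = set w"
    using assms(1) by (cases w) auto
  moreover have "hd w \<in> X" "set (tl w) \<subseteq> X"
    using assms by (cases w, auto)+
  ultimately show "word_max lt w \<in> set w" "\<forall>y\<in>set w. y \<preceq> word_max lt w"
    using run_max[of "hd w" "tl w"] unfolding word_max_def by blast+
qed

lemma word_max_eqI:
  assumes "set w \<subseteq> X" "m \<in> set w" "\<forall>y\<in>set w. y \<preceq> m"
  shows "word_max lt w = m"
proof -
  have "w \<noteq> []" using assms(2) by auto
  with word_max[OF _ assms(1)] assms(2,3) have "m \<preceq> word_max lt w" "word_max lt w \<preceq> m"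
    by blast+
  then show ?thesis using asym by blast
qed

end

section \<open>Walks and their dependence on the lower end point\<close>

context succ_card
begin

lemma small_inj: "inj_on f A \<Longrightarrow> f ` A \<subseteq> B \<Longrightarrow> |B| <o |L| \<Longrightarrow> |A| <o |L|"
  using card_of_ordLeq[of A B] ordLeq_ordLess_trans by blast

lemma L_seg_le: "m \<in> L \<Longrightarrow> |{k. L.le k m}| <o |L|"
proof -
  assume "m \<in> L"
  moreover have "{k. L.le k m} \<subseteq> insert m {k. k \<sqsubset> m}" by blast
  ultimately show ?thesis
    using small_subset small_insert L_seg by metis
qed

text \<open>The element of \<open>[i, t)\<close> with the least \<open>emb t\<close>-value. It equals \<open>min (C\<^sub>t - i)\<close>, the usual
  next step of a walk, where \<open>C\<^sub>t\<close> consists of the \<open>c < t\<close> that exceed all \<open>c' < t\<close> of smaller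
  \<open>emb t\<close>-value.\<close>

definition nx :: "'i \<Rightarrow> 'i \<Rightarrow> 'i"
  where "nx t i = (SOME c. i \<preceq> c \<and> c \<prec> t \<and> (\<forall>c'. i \<preceq> c' \<and> c' \<prec> t \<and> c' \<noteq> c \<longrightarrow> emb t c \<sqsubset> emb t c'))"

lemma nx:
  assumes "i \<prec> t"
  shows "i \<preceq> nx t i" "nx t i \<prec> t"
    "i \<preceq> c' \<Longrightarrow> c' \<prec> t \<Longrightarrow> c' \<noteq> nx t i \<Longrightarrow> emb t (nx t i) \<sqsubset> emb t c'"
proof -
  have t: "t \<in> X" using assms dom by blast
  define P where "P l \<longleftrightarrow> (\<exists>c. i \<preceq> c \<and> c \<prec> t \<and> emb t c = l)" for l
  have "P (emb t i)" unfolding P_def using assms by blast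
  from L.least[of P, OF this] obtain c where c: "i \<preceq> c" "c \<prec> t" "\<forall>l. P l \<longrightarrow> \<not> l \<sqsubset> emb t c"
    unfolding P_def by blast
  have "emb t c \<sqsubset> emb t c'" if c': "i \<preceq> c'" "c' \<prec> t" "c' \<noteq> c" for c'
  proof -
    have "\<not> emb t c' \<sqsubset> emb t c" using c(3) c'(1,2) unfolding P_def by blast
    moreover have "emb t c \<noteq> emb t c'"
      using emb(1)[OF t] c(2) c'(2,3) unfolding inj_on_def by blast
    ultimately show ?thesis
      using L.total emb(2)[OF t] c(2) c'(2) by blast
  qed
  with c(1,2) have "\<exists>c. i \<preceq> c \<and> c \<prec> t \<and> (\<forall>c'. i \<preceq> c' \<and> c' \<prec> t \<and> c' \<noteq> c \<longrightarrow> emb t c \<sqsubset> emb t c')"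
    by blast
  from someI_ex[OF this] show "i \<preceq> nx t i" "nx t i \<prec> t"
    "i \<preceq> c' \<Longrightarrow> c' \<prec> t \<Longrightarrow> c' \<noteq> nx t i \<Longrightarrow> emb t (nx t i) \<sqsubset> emb t c'"
    unfolding nx_def by blast+
qed

lemma nx_eqI:
  assumes "i \<preceq> c" "c \<prec> t" "\<And>c'. i \<preceq> c' \<Longrightarrow> c' \<prec> t \<Longrightarrow> c' \<noteq> c \<Longrightarrow> \<not> emb t c' \<sqsubset> emb t c"
  shows "nx t i = c"
proof (rule ccontr)
  assume ne: "nx t i \<noteq> c"
  have it: "i \<prec> t" using assms(1,2) le_lt by blast
  from nx(3)[OF it assms(1,2)] ne have "emb t (nx t i) \<sqsubset> emb t c" by simp
  with assms(3) nx(1,2)[OF it] ne show False by blast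
qed

text \<open>The end point \<open>i\<close> is left out, so that walks can be concatenated at an
  intermediate node.\<close>

definition walk :: "'i \<Rightarrow> 'i \<Rightarrow> 'i list"
  where "walk j i = wfrec {(x, y). x \<prec> y} (\<lambda>f t. if i \<prec> t then t # f (nx t i) else []) j"

lemma walk_rec: "walk j i = (if i \<prec> j then j # walk (nx j i) i else [])"
  unfolding walk_def by (subst wfrec[OF wf_lt]) (simp add: cut_apply nx(2))

lemma walk_refl [simp]: "walk i i = []"
  by (subst walk_rec) (simp add: irrefl)

lemma walk_step: "i \<prec> j \<Longrightarrow> walk j i = j # walk (nx j i) i"
  by (subst walk_rec) simp

lemma wf_induct_lt: "(\<And>x. (\<And>y. y \<prec> x \<Longrightarrow> P y) \<Longrightarrow> P x) \<Longrightarrow> P a"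
  using wf_induct_rule[OF wf_lt, of P a] by blast

lemma walk_above: "t \<in> set (walk j i) \<Longrightarrow> i \<prec> t"
proof (induction j rule: wf_induct_lt)
  case (1 j)
  show ?case
  proof (cases "i \<prec> j")
    case True
    with "1.prems" consider "t = j" | "t \<in> set (walk (nx j i) i)"
      by (auto simp: walk_step)
    then show ?thesis
      using True "1.IH"[OF nx(2)[OF True]] by cases simp_all
  next
    case False
    with "1.prems" show ?thesis by (simp add: walk_rec)
  qed
qed

text \<open>Towards every end point in \<open>[e, d)\<close> the walk passes through
  \<open>d\<close> and has the same nodes and steps above \<open>d\<close>. The steps are recorded
  because letters may depend on them.\<close>

definition near :: "'i \<Rightarrow> 'i \<Rightarrow> 'i \<Rightarrow> bool"
  where "near j d e \<longleftrightarrow> (\<forall>i. e \<preceq> i \<and> i \<prec> d \<longrightarrow>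
    walk j i = walk j d @ walk d i \<and> (\<forall>t\<in>set (walk j d). nx t i = nx t d))"

lemma near_mono: "near j d e \<Longrightarrow> e \<preceq> e' \<Longrightarrow> near j d e'"
  unfolding near_def using le_trans by blast

lemma E_fin_bound:
  assumes d: "d \<in> E" and "finite A" "\<forall>a\<in>A. a \<prec> d"
  obtains e where "e \<prec> d" "\<forall>a\<in>A. a \<preceq> e"
  using fin_bound[OF assms(2,3) E_pred[OF d]] by blast

text \<open>Fewer than \<open>|L|\<close> points below \<open>d\<close> have a smaller
  \<open>emb t\<close>-value than \<open>nx t d\<close>, so they are bounded below \<open>d\<close>.
  Past the bound the minimum is still attained at \<open>nx t d\<close>.\<close>

lemma nx_near:
  assumes d: "d \<in> E" "d \<prec> t"
  obtains e where "e \<prec> d" "\<And>i. e \<preceq> i \<Longrightarrow> i \<prec> d \<Longrightarrow> nx t i = nx t d"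
proof -
  have t: "t \<in> X" using d dom by blast
  let ?c = "nx t d"
  let ?B = "{c'. c' \<prec> d \<and> emb t c' \<sqsubset> emb t ?c}"
  have "|?B| <o |L|"
  proof (rule small_inj)
    have "?B \<subseteq> {y. y \<prec> t}"
      using trans[OF _ d(2)] by blast
    then show "inj_on (emb t) ?B"
      by (rule inj_on_subset[OF emb(1)[OF t]])
    show "emb t ` ?B \<subseteq> {k. k \<sqsubset> emb t ?c}" by blast
    show "|{k. k \<sqsubset> emb t ?c}| <o |L|"
      by (rule L_seg[OF emb(2)[OF t nx(2)[OF d(2)]]])
  qed
  then obtain e where e: "e \<prec> d" "\<forall>c'\<in>?B. c' \<prec> e"
    using E_bound[OF d(1), of ?B "\<lambda>x. x"] by (metis (no_types, lifting) mem_Collect_eq)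
  have "nx t i = ?c" if i: "e \<preceq> i" "i \<prec> d" for i
  proof (rule nx_eqI)
    show "i \<preceq> ?c" using trans[OF i(2)] i(2) nx(1)[OF d(2)] by metis
    show "?c \<prec> t" using nx(2)[OF d(2)] .
    fix c' assume c': "i \<preceq> c'" "c' \<prec> t" "c' \<noteq> ?c"
    show "\<not> emb t c' \<sqsubset> emb t ?c"
    proof (cases "c' \<prec> d")
      case True
      have "\<not> c' \<prec> e" using i(1) c'(1) trans asym irrefl by metis
      with e(2) True show ?thesis by blast
    next
      case False
      then have "d \<preceq> c'" using total[of c' d] c'(2) dom d(1) E_X by blast
      then show ?thesis using nx(3)[OF d(2)] c'(2,3) L.asym by blast
    qed
  qed
  with e(1) that show ?thesis by blast
qed

text \<open>Induction along the walk: one bound secures the first step from \<open>j\<close>,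
  another the walk from \<open>nx j d\<close> on, and the larger one serves for both.\<close>

lemma near_ex1:
  assumes d: "d \<in> E"
  shows "d \<prec> j \<Longrightarrow> \<exists>e. e \<prec> d \<and> near j d e"
proof (induction j rule: wf_induct_lt)
  case (1 j)
  obtain e1 where e1: "e1 \<prec> d" "\<And>i. e1 \<preceq> i \<Longrightarrow> i \<prec> d \<Longrightarrow> nx j i = nx j d"
    using nx_near[OF d "1.prems"] by blast
  have "\<exists>e2. e2 \<prec> d \<and> near (nx j d) d e2"
  proof (cases "nx j d = d")
    case True
    with e1(1) show ?thesis unfolding near_def by auto
  next
    case False
    with nx(1)[OF "1.prems"] have "d \<prec> nx j d" by auto
    then show ?thesis by (rule "1.IH"[OF nx(2)[OF "1.prems"]])
  qed
  then obtain e2 where e2: "e2 \<prec> d" "near (nx j d) d e2" by blast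
  obtain e where e: "e \<prec> d" "e1 \<preceq> e" "e2 \<preceq> e"
    using E_fin_bound[OF d, of "{e1, e2}"] e1(1) e2(1) by auto
  have "near j d e"
    unfolding near_def
  proof (intro allI impI)
    fix i assume i: "e \<preceq> i \<and> i \<prec> d"
    then have nxi: "nx j i = nx j d"
      using e1(2)[of i] le_trans[OF e(2)] by blast
    have n: "walk (nx j d) i = walk (nx j d) d @ walk d i" "\<forall>t\<in>set (walk (nx j d) d). nx t i = nx t d"
      using near_mono[OF e2(2) e(3)] i unfolding near_def by blast+
    have "walk j i = j # walk (nx j d) i"
      using walk_step[of i j] trans[of i d j] i "1.prems" nxi by simp
    then show "walk j i = walk j d @ walk d i \<and> (\<forall>t\<in>set (walk j d). nx t i = nx t d)"
      using n walk_step[OF "1.prems"] nxi by simp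
  qed
  with e(1) show ?case by blast
qed

lemma near_ex:
  assumes d: "d \<in> E" and B: "finite B" "\<forall>j\<in>B. d \<prec> j"
  obtains e where "e \<prec> d" "\<forall>j\<in>B. near j d e"
proof -
  from near_ex1[OF d] B(2) obtain f where f: "\<And>j. j \<in> B \<Longrightarrow> f j \<prec> d \<and> near j d (f j)"
    by metis
  obtain e where "e \<prec> d" "\<forall>a\<in>f ` B. a \<preceq> e"
    using E_fin_bound[OF d, of "f ` B"] B(1) f by blast
  with f near_mono that show ?thesis by blast
qed

text \<open>A letter may see the node and the step taken from it: \<open>emb\<close> reads both,
  while the labels of the limit case read only the node.\<close>

definition word :: "('i \<Rightarrow> 'i \<Rightarrow> 'n) \<Rightarrow> 'i \<Rightarrow> 'i \<Rightarrow> 'n list"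
  where "word f j i = map (\<lambda>t. f t (nx t i)) (walk j i)"

lemma word_near: "near j d e \<Longrightarrow> e \<preceq> i \<Longrightarrow> i \<prec> d \<Longrightarrow> word f j i = word f j d @ word f d i"
  unfolding near_def word_def by auto

lemma walk_near: "near j d e \<Longrightarrow> e \<preceq> i \<Longrightarrow> i \<prec> d \<Longrightarrow> walk j i = walk j d @ walk d i"
  unfolding near_def by auto

lemma word_step: "i \<prec> j \<Longrightarrow> word f j i = f j (nx j i) # tl (word f j i)"
  unfolding word_def by (simp add: walk_step)

text \<open>By injectivity of \<open>emb d\<close>, fewer than \<open>|L|\<close> points have value
  at most \<open>m\<close>; as \<open>d\<close> has cofinality \<open>|L|\<close>, they are bounded
  below \<open>d\<close>.\<close>

lemma emb_nx_large:
  assumes d: "d \<in> E" and m: "m \<in> L"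
  obtains e where "e \<prec> d" "\<And>i. e \<preceq> i \<Longrightarrow> i \<prec> d \<Longrightarrow> m \<sqsubset> emb d (nx d i)"
proof -
  have dX: "d \<in> X" using d E_X by blast
  let ?B = "{c. c \<prec> d \<and> L.le (emb d c) m}"
  have "|?B| <o |L|"
  proof (rule small_inj)
    have "?B \<subseteq> {y. y \<prec> d}"
      by blast
    then show "inj_on (emb d) ?B"
      by (rule inj_on_subset[OF emb(1)[OF dX]])
    show "emb d ` ?B \<subseteq> {k. L.le k m}" by blast
    show "|{k. L.le k m}| <o |L|"
      using L_seg_le m by blast
  qed
  then obtain e where e: "e \<prec> d" "\<forall>c'\<in>?B. c' \<prec> e"
    using E_bound[OF d(1), of ?B "\<lambda>x. x"] by (metis (no_types, lifting) mem_Collect_eq)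
  have "m \<sqsubset> emb d (nx d i)" if i: "e \<preceq> i" "i \<prec> d" for i
  proof -
    have "\<not> nx d i \<prec> e" using nx(1)[OF i(2)] i(1) trans asym irrefl by metis
    then have "\<not> L.le (emb d (nx d i)) m"
      using e(2) nx(2)[OF i(2)] by blast
    then show ?thesis
      using L.total[of m "emb d (nx d i)"] m emb(2)[OF dX nx(2)[OF i(2)]] by blast
  qed
  with e(1) that show ?thesis by blast
qed

end

section \<open>Rich colourings\<close>

lemma claims_from_set:
  "Some c \<in> set (claims_from lt ob m xs) \<Longrightarrow> \<exists>x\<in>insert m (set xs). \<exists>y\<in>set xs. lt x y \<and> c = ob x y"
  by (induction xs arbitrary: m) (fastforce split: if_splits)+

lemma claims_set:
  "Some c \<in> set (claims lt ob w) \<Longrightarrow> \<exists>x\<in>set w. \<exists>y\<in>set w. lt x y \<and> c = ob x y"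
  by (cases w) (fastforce simp: claims_def dest: claims_from_set)+

lemma (in wo_set) fin_strict_bound:
  assumes "\<And>x. x \<in> X \<Longrightarrow> \<exists>y\<in>X. x \<prec> y" "X \<noteq> {}" "finite A" "A \<subseteq> X"
  obtains y where "y \<in> X" "\<forall>a\<in>A. a \<prec> y"
proof (cases "A = {}")
  case True
  with assms(2) that show ?thesis by blast
next
  case False
  then obtain m where m: "m \<in> A" "\<forall>a\<in>A. a \<preceq> m"
    using fin_max[OF assms(3) _ assms(4)] by blast
  with assms(1,4) obtain y where "y \<in> X" "m \<prec> y" by blast
  with m that le_lt show ?thesis by blast
qed

section \<open>Rich colourings for successor cardinals\<close>

context succ_card
begin

text \<open>Families tending to the top are indexed so that the sets at \<open>x\<close> lie above
  \<open>x\<close>. They need be neither disjoint nor of constant size.\<close>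

definition rich :: "'x set \<Rightarrow> ('i \<Rightarrow> 'i \<Rightarrow> 'x) \<Rightarrow> bool"
  where "rich K p \<longleftrightarrow> (\<forall>k\<in>K. \<forall>a b.
    (\<forall>x\<in>X. finite (a x) \<and> finite (b x) \<and> (\<forall>i\<in>a x \<union> b x. x \<prec> i)) \<longrightarrow>
    (\<exists>x\<in>X. \<exists>y\<in>X. \<forall>i\<in>a x. \<forall>j\<in>b y. i \<prec> j \<and> p i j = k))"

lemma word_emb_L: "set (word emb j i) \<subseteq> L"
proof -
  have "emb t (nx t i) \<in> L" if "t \<in> set (walk j i)" for t
    using walk_above[OF that] nx(2) emb(2) dom(2) by blast
  then show ?thesis unfolding word_def by auto
qed

lemma X_fin_bound:
  assumes "finite A" "A \<subseteq> X"
  obtains y where "y \<in> X" "\<forall>a\<in>A. a \<prec> y"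
  using X_bound[OF assms(2) le_finite[OF assms(1)]] by blast

lemma label_function:
  assumes "\<And>k k'. k \<in> K \<Longrightarrow> k' \<in> K \<Longrightarrow> k \<noteq> k' \<Longrightarrow> S k \<inter> S k' = {}"
  obtains lab where "\<And>k d. k \<in> K \<Longrightarrow> d \<in> S k \<Longrightarrow> lab d = k"
proof
  fix k d assume "k \<in> K" "d \<in> S k"
  then show "(THE k. k \<in> K \<and> d \<in> S k) = k"
    using assms by (intro the_equality) blast+
qed

text \<open>Recursion along \<open>M\<close> puts \<open>h m\<close> above all earlier
  \<open>h n\<close> and \<open>F (h n)\<close>. Regularity leaves room for this, and
  \<open>F (h m)\<close> lies above \<open>h m\<close>.\<close>

lemma disjoint_subfamily:
  fixes M :: "'m set" and ltM :: "'m \<Rightarrow> 'm \<Rightarrow> bool"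
  assumes M: "wo_set M ltM" "\<And>m. m \<in> M \<Longrightarrow> |{n. ltM n m}| <o |L|"
    and A: "L.unbounded A"
    and F: "\<And>m. m \<in> A \<Longrightarrow> finite (F m) \<and> F m \<subseteq> L \<and> (\<forall>y\<in>F m. m \<sqsubset> y)"
  obtains h where "h ` M \<subseteq> A" "\<And>m n. m \<in> M \<Longrightarrow> n \<in> M \<Longrightarrow> m \<noteq> n \<Longrightarrow> F (h m) \<inter> F (h n) = {}"
proof -
  interpret M: wo_set M ltM by fact
  define h where "h = wfrec {(x, y). ltM x y}
    (\<lambda>h m. SOME a. a \<in> A \<and> (\<forall>n. ltM n m \<longrightarrow> (\<forall>y\<in>insert (h n) (F (h n)). y \<sqsubset> a)))"
  have h_rec: "h m = (SOME a. a \<in> A \<and> (\<forall>n. ltM n m \<longrightarrow> (\<forall>y\<in>insert (h n) (F (h n)). y \<sqsubset> a)))" for m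
    unfolding h_def by (subst wfrec[OF M.wf_lt]) (simp add: cut_apply cong: imp_cong)
  have h: "m \<in> M \<longrightarrow> h m \<in> A \<and> (\<forall>n. ltM n m \<longrightarrow> (\<forall>y\<in>insert (h n) (F (h n)). y \<sqsubset> h m))" for m
  proof (induction m rule: wf_induct_rule[OF M.wf_lt])
    case (1 m)
    show ?case
    proof
      assume m: "m \<in> M"
      have IH: "h n \<in> A" if "ltM n m" for n
        using 1 that M.dom by blast
      have "|\<Union>n\<in>{n. ltM n m}. insert (h n) (F (h n))| <o |L|"
        using F IH by (intro small_UN[OF M(2)[OF m]] small_finite) auto
      moreover have "(\<Union>n\<in>{n. ltM n m}. insert (h n) (F (h n))) \<subseteq> L"
        using F IH A unfolding L.unbounded_def by blast
      ultimately obtain l where l: "l \<in> L" "\<forall>y\<in>(\<Union>n\<in>{n. ltM n m}. insert (h n) (F (h n))). y \<sqsubset> l"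
        using L_bound by metis
      then obtain a where "a \<in> A" "l \<sqsubset> a"
        using A unfolding L.unbounded_def by blast
      with l(2) have "a \<in> A \<and> (\<forall>n. ltM n m \<longrightarrow> (\<forall>y\<in>insert (h n) (F (h n)). y \<sqsubset> a))"
        using L.trans by blast
      from someI[of "\<lambda>a. a \<in> A \<and> (\<forall>n. ltM n m \<longrightarrow> (\<forall>y\<in>insert (h n) (F (h n)). y \<sqsubset> a))", OF this]
      show "h m \<in> A \<and> (\<forall>n. ltM n m \<longrightarrow> (\<forall>y\<in>insert (h n) (F (h n)). y \<sqsubset> h m))"
        unfolding h_rec[of m] .
    qed
  qed
  have disj: "F (h n) \<inter> F (h m) = {}" if "ltM n m" for m n
  proof -
    have "m \<in> M" using that M.dom by blast
    then have "\<forall>y\<in>F (h n). y \<sqsubset> h m" "\<forall>y\<in>F (h m). h m \<sqsubset> y"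
      using h[of m] F that by blast+
    then show ?thesis using L.asym by blast
  qed
  show ?thesis
  proof
    show "h ` M \<subseteq> A" using h by blast
    show "F (h m) \<inter> F (h n) = {}" if "m \<in> M" "n \<in> M" "m \<noteq> n" for m n
      using M.total[OF that(1,2)] that(3) disj[of m n] disj[of n m] by blast
  qed
qed

text \<open>The walk from \<open>b y\<close> to \<open>a x\<close> passes through a prescribed point \<open>d\<close>, at which the letter is
  larger than all earlier ones. The letters above \<open>d\<close> vary through \<open>|M|\<close> many disjoint finite sets,
  so the claim made at \<open>d\<close> can be made larger than all other claims.\<close>

lemma rich_succ:
  fixes M :: "'m set" and ltM :: "'m \<Rightarrow> 'm \<Rightarrow> bool" and K :: "'x set"
  assumes M: "wo_set M ltM" "|M| <o |L|" "\<And>m. m \<in> M \<Longrightarrow> |{n. ltM n m}| <o |M|"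
      "\<And>m. m \<in> M \<Longrightarrow> \<exists>n\<in>M. ltM m n" "M \<noteq> {}"
    and LM: "\<And>A::'l set. |A| <o |L| \<Longrightarrow> |A| \<le>o |M|"
    and K: "|K| \<le>o |L|"
  shows "\<exists>p. rich K p"
proof -
  interpret M: wo_set M ltM by fact
  have "\<forall>z. \<exists>e. z \<in> L \<longrightarrow> inj_on e {y. y \<sqsubset> z} \<and> e ` {y. y \<sqsubset> z} \<subseteq> M"
    using LM[OF L_seg] card_of_ordLeq by metis
  then obtain e where e: "\<And>z. z \<in> L \<Longrightarrow> inj_on (e z) {y. y \<sqsubset> z} \<and> e z ` {y. y \<sqsubset> z} \<subseteq> M"
    by metis
  \<comment> \<open>For a fixed new maximum \<open>z\<close>, distinct old maxima make distinct
    claims.\<close>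
  define ob where "ob y z = e z y" for y z
  have obM: "ob y z \<in> M" if "y \<sqsubset> z" for y z
    using e[of z] L.dom[OF that] that unfolding ob_def by blast
  obtain S where S: "\<And>k. k \<in> K \<Longrightarrow> stationary (S k)" "\<And>k. k \<in> K \<Longrightarrow> S k \<subseteq> E"
    "\<And>k k'. k \<in> K \<Longrightarrow> k' \<in> K \<Longrightarrow> k \<noteq> k' \<Longrightarrow> S k \<inter> S k' = {}"
    using stationary_family[OF K] by metis
  obtain lab where lab: "\<And>k d. k \<in> K \<Longrightarrow> d \<in> S k \<Longrightarrow> lab d = k"
    using label_function[of K S, OF S(3)] by blast
  \<comment> \<open>The claim is made by the letter of the wanted node itself, hence the shift
    0.\<close>
  define p where "p i j = lab (walk j i ! split_pos ltL ob ltM (\<lambda>_. 0) (word emb j i))" for i j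
  have "rich K p"
    unfolding rich_def
  proof (intro ballI allI impI)
    fix k and a b :: "'i \<Rightarrow> 'i set"
    assume k: "k \<in> K"
      and ab: "\<forall>x\<in>X. finite (a x) \<and> finite (b x) \<and> (\<forall>i\<in>a x \<union> b x. x \<prec> i)"
    have "\<exists>y\<in>X. \<forall>i\<in>a x. i \<prec> y" if "x \<in> X" for x
    proof -
      have "finite (a x)" "a x \<subseteq> X"
        using ab that dom(2) by blast+
      then show ?thesis
        using X_fin_bound by metis
    qed
    then obtain ga where ga: "\<And>x. x \<in> X \<Longrightarrow> ga x \<in> X \<and> (\<forall>i\<in>a x. i \<prec> ga x)"
      by metis

    have "\<exists>e. e \<prec> v \<and> (\<forall>j\<in>b v. near j v e) \<and> (\<forall>i. e \<preceq> i \<and> i \<prec> v \<longrightarrow> m \<sqsubset> emb v (nx v i))"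
      if m: "m \<in> L" and v: "v \<in> E" for m v
    proof -
      obtain e1 where e1: "e1 \<prec> v" "\<forall>j\<in>b v. near j v e1"
        using near_ex[OF v, of "b v"] ab E_X[OF v] by blast
      obtain e2 where e2: "e2 \<prec> v" "\<And>i. e2 \<preceq> i \<Longrightarrow> i \<prec> v \<Longrightarrow> m \<sqsubset> emb v (nx v i)"
        using emb_nx_large[OF v m] by blast
      obtain e where "e \<prec> v" "e1 \<preceq> e" "e2 \<preceq> e"
        using E_fin_bound[OF v, of "{e1, e2}"] e1(1) e2(1) by auto
      moreover have "\<forall>j\<in>b v. near j v e"
        using near_mono e1(2) \<open>e1 \<preceq> e\<close> by blast
      moreover have "\<forall>i. e \<preceq> i \<and> i \<prec> v \<longrightarrow> m \<sqsubset> emb v (nx v i)"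
        using e2(2) le_trans[OF \<open>e2 \<preceq> e\<close>] by blast
      ultimately show ?thesis
        by blast
    qed
    \<comment> \<open>From \<open>e1 m v\<close> up to \<open>v\<close>, walks from
      \<open>b v\<close> pass through \<open>v\<close> and leave it with a letter above
      \<open>m\<close>.\<close>
    then obtain e1 where e1: "\<And>m v. m \<in> L \<Longrightarrow> v \<in> E \<Longrightarrow> e1 m v \<prec> v"
      "\<And>m v j. m \<in> L \<Longrightarrow> v \<in> E \<Longrightarrow> j \<in> b v \<Longrightarrow> near j v (e1 m v)"
      "\<And>m v i. m \<in> L \<Longrightarrow> v \<in> E \<Longrightarrow> e1 m v \<preceq> i \<and> i \<prec> v \<Longrightarrow> m \<sqsubset> emb v (nx v i)"
      by metis
    \<comment> \<open>Pressing down gives a bound \<open>h0 m\<close> valid for unboundedly many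
      \<open>v\<close>. Thus \<open>d\<close> can be fixed first, above all these bounds, and
      suitable \<open>v m\<close> are found above \<open>d\<close> afterwards.\<close>
    have "\<exists>x\<in>X. \<forall>y\<in>X. \<exists>v\<in>E. y \<prec> v \<and> e1 m v \<preceq> x" if "m \<in> L" for m
      by (rule Fodor[OF stationary_E, of "e1 m"]) (use e1(1)[OF that] in blast)+
    then obtain h0 where h0: "\<And>m. m \<in> L \<Longrightarrow> h0 m \<in> X"
      "\<And>m y. m \<in> L \<Longrightarrow> y \<in> X \<Longrightarrow> \<exists>v\<in>E. y \<prec> v \<and> e1 m v \<preceq> h0 m"
      by metis
    have "h0 ` L \<subseteq> X" using h0(1) by blast
    then obtain hs where hs: "hs \<in> X" "\<And>m. m \<in> L \<Longrightarrow> h0 m \<prec> hs"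
      using X_bound[OF _ le_image[OF le_refl, of h0]] by auto

    have "\<exists>d\<in>E. club_pt ga d \<and> x \<prec> d" if "x \<in> X" for x
      using stationaryD[OF stationary_E order.refl _ that, of ga] ga by metis
    then obtain g where g: "\<And>x. x \<in> X \<Longrightarrow> g x \<in> E \<and> club_pt ga (g x) \<and> x \<prec> g x"
      by metis
    \<comment> \<open>Closure under \<open>g\<close> provides a closure point of \<open>ga\<close>
      between any \<open>x0 \<prec> d\<close> and \<open>d\<close>.\<close>
    obtain d where d: "d \<in> S k" "club_pt g d" "hs \<prec> d"
      using stationaryD[OF S(1,2)[OF k] _ hs(1), of g] g E_X by blast
    have dE: "d \<in> E" and dX: "d \<in> X" using d(1) S(2)[OF k] E_X by blast+

    have "\<exists>v\<in>E. d \<prec> v \<and> e1 m v \<preceq> h0 m" if "m \<in> L" for m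
      using h0(2)[OF that dX] .
    then obtain v where v: "\<And>m. m \<in> L \<Longrightarrow> v m \<in> E \<and> d \<prec> v m \<and> e1 m (v m) \<preceq> h0 m"
      by metis
    have e1d: "e1 m (v m) \<preceq> d" if "m \<in> L" for m
      using v[OF that] hs(2)[OF that] d(3) trans by (metis (no_types))
    have vj: "v m \<prec> j" "d \<prec> j" if "m \<in> L" "j \<in> b (v m)" for m j
      using v[OF that(1)] ab E_X that(2) trans by (metis UnCI)+
    \<comment> \<open>The maxima of the words above \<open>d\<close>. They exceed \<open>m\<close>
      because the walk leaves \<open>v m\<close> with a letter above \<open>m\<close>.\<close>
    define F where "F m = (\<lambda>j. word_max ltL (word emb j d)) ` b (v m)" for m
    have finF: "finite (F m)" if "m \<in> L" for m
      unfolding F_def using ab E_X v[OF that] by blast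
    have F: "m \<sqsubset> word_max ltL (word emb j d)" "word_max ltL (word emb j d) \<in> L"
      if m: "m \<in> L" and j: "j \<in> b (v m)" for m j
    proof -
      have "near j (v m) (e1 m (v m))" using e1(2) v m j by blast
      then have w: "word emb j d = word emb j (v m) @ word emb (v m) d"
        using word_near e1d[OF m] v[OF m] by blast
      have "emb (v m) (nx (v m) d) \<in> set (word emb (v m) d)"
        using word_step[of d "v m" emb] v[OF m] by (metis list.set_intros(1))
      moreover have "m \<sqsubset> emb (v m) (nx (v m) d)"
        using e1(3) e1d v m by blast
      ultimately obtain y where y: "y \<in> set (word emb j d)" "m \<sqsubset> y"
        using w by auto
      have "word emb j d \<noteq> []" using y(1) by auto
      from L.word_max[OF this word_emb_L] y word_emb_L
      show "m \<sqsubset> word_max ltL (word emb j d)" "word_max ltL (word emb j d) \<in> L"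
        using L.lt_le by blast+
    qed
    have "\<exists>e\<in>X. e \<prec> d \<and> (\<forall>j\<in>b (v m). near j d e)" if m: "m \<in> L" for m
      using near_ex[OF dE, of "b (v m)"] vj(2)[OF m] ab v[OF m] E_X dom(1) by metis
    then obtain e2 where e2: "\<And>m. m \<in> L \<Longrightarrow> e2 m \<prec> d"
      "\<And>m j. m \<in> L \<Longrightarrow> j \<in> b (v m) \<Longrightarrow> near j d (e2 m)"
      by metis

    have claimsM: "{c. Some c \<in> set (claims ltL ob w)} \<subseteq> M" for w
      using claims_set obM by fast
    have claims_fromM: "{c. Some c \<in> set (claims_from ltL ob q w)} \<subseteq> M" for q w
      using claims_from_set obM by fast
    have fin_some: "finite {c. Some c \<in> set xs}" for xs :: "'m option list"
      by (rule finite_imageD[of Some]) (auto intro: finite_subset[of _ "set xs"])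
    have "\<exists>c\<in>M. \<forall>j\<in>b (v m). \<forall>c'. Some c' \<in> set (claims ltL ob (word emb j d)) \<longrightarrow> ltM c' c"
      if m: "m \<in> L" for m
    proof -
      have "finite (\<Union>j\<in>b (v m). {c. Some c \<in> set (claims ltL ob (word emb j d))})"
        using ab v[OF m] E_X fin_some by blast
      moreover have "(\<Union>j\<in>b (v m). {c. Some c \<in> set (claims ltL ob (word emb j d))}) \<subseteq> M"
        using claimsM by blast
      ultimately show ?thesis
        using M.fin_strict_bound[OF M(4,5)] by (smt (verit, best) UN_iff mem_Collect_eq)
    qed
    then obtain cb where cb: "\<And>m. m \<in> L \<Longrightarrow> cb m \<in> M"
      "\<And>m j c'. m \<in> L \<Longrightarrow> j \<in> b (v m) \<Longrightarrow> Some c' \<in> set (claims ltL ob (word emb j d)) \<Longrightarrow> ltM c' (cb m)"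
      by metis
    \<comment> \<open>As \<open>|M|\<close> is below \<open>|L|\<close>, unboundedly many
      \<open>m\<close> share one bound on the claims made above \<open>d\<close>.\<close>
    have "|cb ` L| <o |L|"
      using card_of_mono1[of "cb ` L" M] cb(1) M(2) ordLeq_ordLess_trans by blast
    then obtain c1 where c1: "L.unbounded {m\<in>L. cb m = c1}"
      using L_pigeonhole[OF L_unbounded] by blast
    define A where "A = {m\<in>L. cb m = c1}"
    have c1M: "c1 \<in> M"
      using c1 cb(1) infinite_L unfolding L.unbounded_def
      by (metis (mono_tags, lifting) all_not_in_conv infinite_imp_nonempty mem_Collect_eq)
    have "m \<in> A \<Longrightarrow> finite (F m) \<and> F m \<subseteq> L \<and> (\<forall>y\<in>F m. m \<sqsubset> y)" for m
      using finF F unfolding F_def A_def by blast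
    moreover have "|{n. ltM n m}| <o |L|" if "m \<in> M" for m
      using M(2) M(3)[OF that] ordLess_transitive by blast
    ultimately obtain h where h: "h ` M \<subseteq> A"
      "\<And>m n. m \<in> M \<Longrightarrow> n \<in> M \<Longrightarrow> m \<noteq> n \<Longrightarrow> F (h m) \<inter> F (h n) = {}"
      using disjoint_subfamily[OF M(1) _ c1[folded A_def], of F] by metis
    have hL: "h n \<in> L" if "n \<in> M" for n
      using h(1) that unfolding A_def by blast

    obtain x2 where x2: "x2 \<prec> d" "\<forall>n\<in>M. e2 (h n) \<prec> x2"
      using E_bound[OF dE M(2), of "\<lambda>n. e2 (h n)"] e2(1) hL by blast
    have "(\<Union>n\<in>M. F (h n)) \<subseteq> L"
      using F(2) hL unfolding F_def by blast
    moreover have "|\<Union>n\<in>M. F (h n)| <o |L|"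
      using finF hL by (intro small_UN[OF M(2)] small_finite) auto
    ultimately obtain q0 where q0: "q0 \<in> L" "\<forall>y\<in>(\<Union>n\<in>M. F (h n)). y \<sqsubset> q0"
      using L_bound by metis
    \<comment> \<open>Near \<open>d\<close> the letter at \<open>d\<close> exceeds
      \<open>q0\<close>, so it is a new maximum for every candidate \<open>h n\<close>.\<close>
    obtain e3 where e3: "e3 \<prec> d" "\<And>i. e3 \<preceq> i \<Longrightarrow> i \<prec> d \<Longrightarrow> q0 \<sqsubset> emb d (nx d i)"
      using emb_nx_large[OF dE q0(1)] by blast
    obtain x0 where x0: "x0 \<prec> d" "x2 \<preceq> x0" "e3 \<preceq> x0"
      using E_fin_bound[OF dE, of "{x2, e3}"] x2(1) e3(1) by auto
    \<comment> \<open>The set \<open>a x1\<close> will lie between \<open>x1\<close> and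
      \<open>c\<close>, so all walks from \<open>d\<close> to it start with the same step and the
      same letter \<open>q\<close>.\<close>
    define c where "c = g x0"
    have c: "c \<in> E" "club_pt ga c" "x0 \<prec> c" "c \<prec> d"
      using g[of x0] dom(1)[OF x0(1)] d(2) x0(1) unfolding c_def club_pt_def by blast+
    obtain e4 where e4: "e4 \<prec> c" "near d c e4"
      using near_ex1[OF c(1,4)] by blast
    obtain x1 where x1: "x1 \<prec> c" "x0 \<preceq> x1" "e4 \<preceq> x1"
      using E_fin_bound[OF c(1), of "{x0, e4}"] c(3) e4(1) by auto
    have x1X: "x1 \<in> X" using x1(1) dom(1) by blast
    have ai: "x1 \<prec> i" "i \<prec> c" "i \<prec> d" if "i \<in> a x1" for i
    proof -
      show "x1 \<prec> i" using ab x1X that by blast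
      have "ga x1 \<prec> c" using c(2) x1(1) unfolding club_pt_def by blast
      then show "i \<prec> c" using ga[OF x1X] that trans by blast
      then show "i \<prec> d" using c(4) trans by blast
    qed
    define q where "q = emb d (nx d c)"
    have q: "q0 \<sqsubset> q"
      unfolding q_def using e3(2) c(3,4) x0(3) le_lt by blast
    have wq: "word emb d i = q # tl (word emb d i)" if "i \<in> a x1" for i
    proof -
      have "nx d i = nx d c"
        using e4(2) x1(3) ai[OF that] walk_step[OF c(4)] le_lt unfolding near_def
        by (metis list.set_intros(1))
      then show ?thesis
        using word_step[OF ai(3)[OF that], of emb] unfolding q_def by simp
    qed
    let ?C = "insert c1 (\<Union>i\<in>a x1. {c. Some c \<in> set (claims_from ltL ob q (tl (word emb d i)))})"
    have "finite ?C" using ab x1X fin_some by blast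
    moreover have "?C \<subseteq> M" using c1M claims_fromM by blast
    \<comment> \<open>\<open>c2\<close> lies above every claim made before or after the letter at
      \<open>d\<close>.\<close>
    ultimately obtain c2 where c2: "c2 \<in> M" "\<forall>c\<in>?C. ltM c c2"
      using M.fin_strict_bound[OF M(4,5)] by metis

    \<comment> \<open>Otherwise every \<open>n\<close> yields a maximum in \<open>F (h n)\<close>
      whose claim against \<open>q\<close> is below \<open>c2\<close>. Disjointness and injectivity
      of \<open>e q\<close> make these \<open>|M|\<close> many values in a proper segment of
      \<open>M\<close>, which is smaller.\<close>
    have "\<exists>n\<in>M. \<forall>y\<in>F (h n). \<not> ltM (ob y q) c2"
    proof (rule ccontr)
      assume "\<not> ?thesis"
      then obtain f where f: "\<And>n. n \<in> M \<Longrightarrow> f n \<in> F (h n) \<and> ltM (ob (f n) q) c2"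
        by metis
      have fq: "f n \<sqsubset> q" if "n \<in> M" for n
        using f[OF that] q0(2) q that L.trans by blast
      have inj: "inj_on (\<lambda>n. ob (f n) q) M"
      proof (rule inj_onI)
        fix m n assume mn: "m \<in> M" "n \<in> M" "ob (f m) q = ob (f n) q"
        have "inj_on (e q) {y. y \<sqsubset> q}" using e L.dom(2)[OF q] by blast
        then have "f m = f n"
          using mn fq unfolding ob_def inj_on_def by blast
        with f[OF mn(1)] f[OF mn(2)] h(2)[OF mn(1,2)] show "m = n" by auto
      qed
      have "(\<lambda>n. ob (f n) q) ` M \<subseteq> {n. ltM n c2}" using f by blast
      with inj have "|M| \<le>o |{n. ltM n c2}|"
        using card_of_ordLeq[of M] by blast
      with M(3)[OF c2(1)] show False
        using not_ordLess_ordLeq by blast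
    qed
    then obtain n where n: "n \<in> M" "\<And>y. y \<in> F (h n) \<Longrightarrow> \<not> ltM (ob y q) c2"
      by blast
    let ?m = "h n"
    have m: "?m \<in> L" using hL n(1) .
    have main: "i \<prec> j \<and> p i j = k" if i: "i \<in> a x1" and j: "j \<in> b (v ?m)" for i j
    proof
      have dj: "d \<prec> j" using vj(2)[OF m j] .
      show "i \<prec> j" using ai(3)[OF i] dj trans by blast
      have "e2 ?m \<preceq> i"
        using x2(2) n(1) x0(2) x1(2) ai(1)[OF i] le_trans trans by blast
      then have nr: "word emb j i = word emb j d @ word emb d i" "walk j i = walk j d @ walk d i"
        using word_near walk_near e2(2)[OF m j] ai(3)[OF i] by blast+
      let ?W = "word_max ltL (word emb j d)"
      have WF: "?W \<in> F ?m" using j unfolding F_def by blast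
      then have Wq: "?W \<sqsubset> q"
        using q0(2) n(1) q L.trans by blast
      have oc: "M.le c2 (ob ?W q)"
        using n(2)[OF WF] M.total[OF obM[OF Wq] c2(1)] by blast
      have "split_pos ltL ob ltM (\<lambda>_. 0) (word emb j d @ [] @ q # tl (word emb d i)) = length (word emb j d)"
      proof (rule split_pos_eq)
        show "\<not> ltM c' c" if "ltM c c'" for c c' using M.asym that .
        show "word emb j d \<noteq> []" using word_step[OF dj, of emb] by auto
        show "ltL ?W q" using Wq .
        show "ltM c (ob ?W q)" if "Some c \<in> set (claims ltL ob (word emb j d))" for c
        proof -
          have "cb ?m = c1" using h(1) n(1) unfolding A_def by blast
          with cb(2)[OF m j that] have "ltM c c1" by simp
          moreover have "ltM c1 c2" using c2(2) by blast
          ultimately show ?thesis using oc M.trans by blast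
        qed
        show "ltM c (ob ?W q)" if "Some c \<in> set (claims_from ltL ob q (tl (word emb d i)))" for c
          using c2(2) i that oc M.lt_le by blast
      qed simp_all
      then have "split_pos ltL ob ltM (\<lambda>_. 0) (word emb j i) = length (walk j d)"
        using nr(1) wq[OF i] by (simp add: word_def)
      then have "walk j i ! split_pos ltL ob ltM (\<lambda>_. 0) (word emb j i) = d"
        using nr(2) walk_step[OF ai(3)[OF i]] by (simp add: nth_append)
      then show "p i j = k"
        unfolding p_def using lab[OF k d(1)] by simp
    qed
    show "\<exists>x\<in>X. \<exists>y\<in>X. \<forall>i\<in>a x. \<forall>j\<in>b y. i \<prec> j \<and> p i j = k"
      using main x1X E_X v[OF m] by blast
  qed
  then show ?thesis by blast
qed

end

section \<open>Rich colourings for limit cardinals\<close>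

context succ_card
begin

text \<open>While the letters following \<open>s\<close> stay bounded, the pigeonhole principle
  fixes one of them for words whose remainder still has arbitrarily large letters, and it is
  appended to \<open>s\<close>. The common length \<open>l\<close> stops the process.\<close>

lemma common_prefix:
  assumes B: "unbounded B" and c: "\<And>x. x \<in> B \<Longrightarrow> set (c x) \<subseteq> X \<and> x \<in> set (c x) \<and> length (c x) = l"
  obtains s where "\<And>x. x \<in> X \<Longrightarrow> \<exists>y\<in>B. \<exists>q u. c y = s @ q # u \<and> x \<prec> q"
proof -
  define good where "good s \<longleftrightarrow> (\<forall>x\<in>X. \<exists>y\<in>B. \<exists>q u. c y = s @ q # u \<and> x \<prec> q)" for s
  have "\<exists>s. good s"
    if "\<forall>x\<in>X. \<exists>y\<in>B. \<exists>u. c y = s @ u \<and> (\<exists>z\<in>set u. x \<prec> z)" for s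
    using that
  proof (induction "l - length s" arbitrary: s rule: less_induct)
    case less
    show ?case
    proof (cases "good s")
      case False
      then obtain x0 where x0: "x0 \<in> X" "\<And>y q u. y \<in> B \<Longrightarrow> c y = s @ q # u \<Longrightarrow> \<not> x0 \<prec> q"
        unfolding good_def by blast
      define N1 where "N1 = {x\<in>X. x0 \<prec> x}"
      have "\<exists>y\<in>B. \<exists>q u. c y = s @ q # u \<and> q \<preceq> x0 \<and> (\<exists>z\<in>set u. x \<prec> z)" if x: "x \<in> N1" for x
      proof -
        obtain y u z where y: "y \<in> B" "c y = s @ u" "z \<in> set u" "x \<prec> z"
          using less.prems x unfolding N1_def by blast
        then obtain q u' where u: "u = q # u'" by (cases u) auto
        have "q \<in> X" using c[OF y(1)] y(2) u by auto
        then have q: "q \<preceq> x0" using x0 y(1,2) u total by blast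
        then have "q \<noteq> z" using y(4) x asym irrefl trans unfolding N1_def by blast
        then have "z \<in> set u'" using y(3) u by auto
        with y u q show ?thesis by blast
      qed
      then obtain f where f: "\<And>x. x \<in> N1 \<Longrightarrow> f x \<preceq> x0 \<and>
          (\<exists>y\<in>B. \<exists>u. c y = s @ f x # u \<and> (\<exists>z\<in>set u. x \<prec> z))"
        by metis
      have N1: "unbounded N1"
        unfolding unbounded_def
      proof (intro conjI ballI)
        fix x assume "x \<in> X"
        then obtain y where "y \<in> X" "x \<prec> y" "x0 \<prec> y"
          using X_fin_bound[of "{x, x0}"] x0(1) by auto
        then show "\<exists>y\<in>N1. x \<prec> y" unfolding N1_def by blast
      qed (auto simp: N1_def)
      have "f ` N1 \<subseteq> {y. y \<prec> x0} \<union> {x0}" using f by blast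
      then have "|f ` N1| \<le>o |{y. y \<prec> x0} \<union> {x0}|" by (rule card_of_mono1)
      also have "|{y. y \<prec> x0} \<union> {x0}| \<le>o |L|"
        using le_Un[OF X_seg[OF x0(1)] le_finite] by blast
      finally obtain q where q: "unbounded {x\<in>N1. f x = q}"
        using X_pigeonhole[OF N1] by blast
      have step: "\<exists>y\<in>B. \<exists>u. c y = (s @ [q]) @ u \<and> (\<exists>z\<in>set u. x \<prec> z)" if "x \<in> X" for x
      proof -
        have "\<exists>x'\<in>{x\<in>N1. f x = q}. x \<prec> x'"
          using q that unfolding unbounded_def by simp
        then obtain x' where x': "x' \<in> N1" "f x' = q" "x \<prec> x'"
          by auto
        with f[of x'] obtain y u z where "y \<in> B" "c y = s @ q # u" "z \<in> set u" "x' \<prec> z"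
          by blast
        then show ?thesis
          using trans[OF x'(3), of z] by (intro bexI[of _ y] exI[of _ u]) auto
      qed
      obtain y where "y \<in> B" "\<exists>u. c y = (s @ [q]) @ u"
        using step[OF x0(1)] by metis
      with c[of y] have "length s < l" by auto
      then have "l - length (s @ [q]) < l - length s" by simp
      from less.hyps[OF this] step show ?thesis by blast
    qed blast
  qed
  from this[of "[]"] have "\<exists>s. good s"
    using B c unfolding unbounded_def by fastforce
  with that show ?thesis unfolding good_def by blast
qed

text \<open>Here the letters are values of a function \<open>h\<close> with stationary fibres. The prescribed point
  \<open>d\<close> lies at a fixed number of steps above the first lower node with a large letter. That number is
  encoded in the claim, whose value is provided by \<open>ob\<close>.\<close>

lemma rich_limit:
  fixes N :: "'n set" and ltN :: "'n \<Rightarrow> 'n \<Rightarrow> bool" and L' :: "'m set" and K :: "'x set"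
    and ob :: "'n \<Rightarrow> 'n \<Rightarrow> nat"
  assumes N: "succ_card N ltN L' ltL'" "|N| <o |L|"
    and ob: "\<And>A B n. wo_set.unbounded N ltN A \<Longrightarrow> wo_set.unbounded N ltN B \<Longrightarrow>
      \<exists>x\<in>A. \<exists>y\<in>B. ltN x y \<and> ob x y = n"
    and K: "|K| \<le>o |L|"
  shows "\<exists>p. rich K p"
proof -
  interpret N: succ_card N ltN L' ltL' by fact
  have NL: "|N| \<le>o |L|" using N(2) ordLess_imp_ordLeq by blast
  \<comment> \<open>One stationary partition serves twice: \<open>Inl\<close> labels provide the
    letters, \<open>Inr\<close> labels the final colours.\<close>
  define KK :: "('n + 'x) set" where "KK = Inl ` N \<union> Inr ` K"
  have "|KK| \<le>o |L|"
    unfolding KK_def using le_Un[OF le_image[OF NL] le_image[OF K]] .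
  then obtain S where S: "\<And>k. k \<in> KK \<Longrightarrow> stationary (S k)" "\<And>k. k \<in> KK \<Longrightarrow> S k \<subseteq> E"
    "\<And>k k'. k \<in> KK \<Longrightarrow> k' \<in> KK \<Longrightarrow> k \<noteq> k' \<Longrightarrow> S k \<inter> S k' = {}"
    using stationary_family by metis
  obtain lab where lab: "\<And>k d. k \<in> KK \<Longrightarrow> d \<in> S k \<Longrightarrow> lab d = k"
    using label_function[of KK S, OF S(3)] by blast
  obtain n0 where n0: "n0 \<in> N" using N.X_nonempty by blast
  \<comment> \<open>The default \<open>n0\<close> keeps \<open>h\<close> total with values in
    \<open>N\<close>; points with a final colour get it too.\<close>
  define h where "h d = (case lab d of Inl n \<Rightarrow> if n \<in> N then n else n0 | Inr k \<Rightarrow> n0)" for d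
  define col where "col d = (case lab d of Inl n \<Rightarrow> undefined | Inr k \<Rightarrow> k)" for d
  have hN: "h d \<in> N" for d
    unfolding h_def using n0 by (auto split: sum.split)
  have SN: "stationary (S (Inl n))" "S (Inl n) \<subseteq> E" "d \<in> S (Inl n) \<Longrightarrow> h d = n" if "n \<in> N" for n d
    using S(1,2)[of "Inl n"] lab[of "Inl n" d] that unfolding KK_def h_def by auto
  have SK: "stationary (S (Inr k))" "S (Inr k) \<subseteq> E" "d \<in> S (Inr k) \<Longrightarrow> col d = k" if "k \<in> K" for k d
    using S(1,2)[of "Inr k"] lab[of "Inr k" d] that unfolding KK_def col_def by auto
  define f where "f t c = h t" for t c :: 'i
  have wordN: "set (word f j i) \<subseteq> N" for j i
    unfolding word_def f_def using hN by auto
  have word_h: "word f j i = map h (walk j i)" for j i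
    unfolding word_def f_def by simp
  define off where "off n = snd (prod_decode n)" for n
  define p where "p i j = col (walk j i ! split_pos ltN ob (<) off (word f j i))" for i j
  have "rich K p"
    unfolding rich_def
  proof (intro ballI allI impI)
    fix k and a b :: "'i \<Rightarrow> 'i set"
    assume k: "k \<in> K"
      and ab: "\<forall>x\<in>X. finite (a x) \<and> finite (b x) \<and> (\<forall>i\<in>a x \<union> b x. x \<prec> i)"
    have "\<exists>y\<in>X. \<forall>i\<in>a x. i \<prec> y" if "x \<in> X" for x
    proof -
      have "finite (a x)" "a x \<subseteq> X"
        using ab that dom(2) by blast+
      then show ?thesis
        using X_fin_bound by metis
    qed
    then obtain ga where ga: "\<And>x. x \<in> X \<Longrightarrow> ga x \<in> X \<and> (\<forall>i\<in>a x. i \<prec> ga x)"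
      by metis

    have "\<exists>e. e \<prec> v \<and> (\<forall>j\<in>b v. near j v e)" if v: "v \<in> E" for v
      using near_ex[OF v, of "b v"] ab E_X[OF v] by (metis UnCI)
    then obtain e0 where e0: "\<And>v. v \<in> E \<Longrightarrow> e0 v \<prec> v" "\<And>v j. v \<in> E \<Longrightarrow> j \<in> b v \<Longrightarrow> near j v (e0 v)"
      by metis
    have "\<exists>m\<in>N. ltN (h v) m \<and> (\<forall>j\<in>b v. \<forall>t\<in>set (walk j v). ltN (h t) m)" if v: "v \<in> E" for v
    proof -
      have "finite (insert (h v) (\<Union>j\<in>b v. h ` set (walk j v)))"
        using ab E_X[OF v] by auto
      moreover have "insert (h v) (\<Union>j\<in>b v. h ` set (walk j v)) \<subseteq> N"
        using hN by blast
      ultimately obtain m where "m \<in> N" "\<forall>y\<in>insert (h v) (\<Union>j\<in>b v. h ` set (walk j v)). ltN y m"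
        using N.X_fin_bound by metis
      then show ?thesis by blast
    qed
    then obtain al where al: "\<And>v. v \<in> E \<Longrightarrow> al v \<in> N" "\<And>v. v \<in> E \<Longrightarrow> ltN (h v) (al v)"
      "\<And>v j t. v \<in> E \<Longrightarrow> j \<in> b v \<Longrightarrow> t \<in> set (walk j v) \<Longrightarrow> ltN (h t) (al v)"
      by metis
    \<comment> \<open>Stationarily many \<open>v\<close> share one bound \<open>m0\<close> on the
      labels at \<open>v\<close> and on the walks down to it.\<close>
    have "E \<subseteq> (\<Union>m\<in>N. {v. al v = m})" using al(1) by blast
    then obtain m0 where m0: "m0 \<in> N" "stationary (E \<inter> {v. al v = m0})"
      using stationary_partition[OF stationary_E order.refl _ NL] by blast
    define E0 where "E0 = {v\<in>E. al v = m0}"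
    have E0: "stationary E0" "E0 \<subseteq> E"
      using m0(2) unfolding E0_def by (auto simp: Int_def)

    \<comment> \<open>From \<open>e\<close> up to \<open>v\<close>, every walk from
      \<open>b th\<close> passes through \<open>th\<close> and then through \<open>v\<close>, which
      contributes the letter \<open>m\<close>.\<close>
    define P where "P m v th e \<longleftrightarrow> v \<in> S (Inl m) \<and> th \<in> E0 \<and> v \<prec> th \<and> e \<prec> v \<and> e0 th \<preceq> e \<and> near th v e"
      for m v th e
    have P_stat: "stationary {v. \<exists>th e. P m v th e}" if m: "m \<in> N" for m
      unfolding stationary_def
    proof (intro allI impI)
      fix g assume g: "\<forall>x\<in>X. g x \<in> X"
      have "\<exists>v\<in>S (Inl m). club_pt g v \<and> x \<prec> v" if "x \<in> X" for x
        using stationaryD[OF SN(1,2)[OF m] g that] by metis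
      then obtain G where G: "\<And>x. x \<in> X \<Longrightarrow> G x \<in> S (Inl m) \<and> club_pt g (G x) \<and> x \<prec> G x"
        by metis
      have GX: "\<forall>x\<in>X. G x \<in> X" using G SN(2)[OF m] E_X by blast
      \<comment> \<open>As \<open>th\<close> is closed under \<open>G\<close>, the point
        \<open>G (e0 th)\<close> lies strictly between \<open>e0 th\<close> and
        \<open>th\<close>.\<close>
      obtain th where th: "th \<in> E0" "club_pt G th"
        using E0(1) GX unfolding stationary_def by blast
      have thE: "th \<in> E" using th(1) E0(2) by blast
      define v where "v = G (e0 th)"
      have e0th: "e0 th \<prec> th" "e0 th \<in> X" using e0(1)[OF thE] dom(1) by blast+
      have v: "v \<in> S (Inl m)" "club_pt g v" "e0 th \<prec> v" "v \<prec> th"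
        using G[OF e0th(2)] th(2) e0th(1) unfolding v_def club_pt_def by blast+
      have vE: "v \<in> E" using v(1) SN(2)[OF m] by blast
      obtain e1 where e1: "e1 \<prec> v" "near th v e1"
        using near_ex1[OF vE v(4)] by blast
      obtain e where e: "e \<prec> v" "e0 th \<preceq> e" "e1 \<preceq> e"
        using E_fin_bound[OF vE, of "{e0 th, e1}"] v(3) e1(1) by auto
      have "P m v th e"
        unfolding P_def using v th(1) e near_mono[OF e1(2)] by blast
      with v(2) show "\<exists>d\<in>{v. \<exists>th e. P m v th e}. club_pt g d" by blast
    qed
    have "\<exists>x\<in>X. \<forall>y\<in>X. \<exists>v th e. P m v th e \<and> y \<prec> v \<and> e \<preceq> x" if m: "m \<in> N" for m
    proof -
      define e where "e v = (SOME e. \<exists>th. P m v th e)" for v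
      have e: "\<exists>th. P m v th (e v)" if "\<exists>th e. P m v th e" for v
        unfolding e_def using that by (intro someI_ex[of "\<lambda>e. \<exists>th. P m v th e"]) blast
      then have "e v \<prec> v" if "v \<in> {v. \<exists>th e. P m v th e}" for v
        using that unfolding P_def by blast
      then obtain x where "x \<in> X" "\<And>y. y \<in> X \<Longrightarrow> \<exists>d\<in>{v. \<exists>th e. P m v th e}. y \<prec> d \<and> e d \<preceq> x"
        using Fodor[OF P_stat[OF m], of e] by metis
      with e show ?thesis by fast
    qed
    then obtain h0 where h0: "\<And>m. m \<in> N \<Longrightarrow> h0 m \<in> X"
      "\<And>m y. m \<in> N \<Longrightarrow> y \<in> X \<Longrightarrow> \<exists>v th e. P m v th e \<and> y \<prec> v \<and> e \<preceq> h0 m"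
      by metis
    have "h0 ` N \<subseteq> X" using h0(1) by blast
    then obtain hs where hs: "hs \<in> X" "\<And>m. m \<in> N \<Longrightarrow> h0 m \<prec> hs"
      using X_bound[OF _ le_image[OF NL, of h0]] by auto

    have "\<exists>d\<in>S (Inl m). club_pt ga d \<and> x \<prec> d" if "m \<in> N" "x \<in> X" for m x
      using stationaryD[OF SN(1,2)[OF that(1)] _ that(2), of ga] ga by metis
    then obtain gm where gm: "\<And>m x. m \<in> N \<Longrightarrow> x \<in> X \<Longrightarrow> gm m x \<in> S (Inl m) \<and> club_pt ga (gm m x) \<and> x \<prec> gm m x"
      by metis
    have "\<exists>y\<in>X. \<forall>m\<in>N. gm m x \<prec> y" if "x \<in> X" for x
    proof -
      have "(\<lambda>m. gm m x) ` N \<subseteq> X" using gm that dom(2) by blast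
      then show ?thesis
        using X_bound[OF _ le_image[OF NL, of "\<lambda>m. gm m x"]] by auto
    qed
    then obtain g where g: "\<And>x. x \<in> X \<Longrightarrow> g x \<in> X \<and> (\<forall>m\<in>N. gm m x \<prec> g x)"
      by metis
    \<comment> \<open>Past any \<open>x0 \<prec> d\<close>, closure under \<open>g\<close> yields
      below \<open>d\<close> a closure point of \<open>ga\<close> for every letter
      \<open>m\<close>.\<close>
    obtain d where d: "d \<in> S (Inr k)" "club_pt g d" "hs \<prec> d"
      using stationaryD[OF SK(1,2)[OF k] _ hs(1), of g] g by blast
    have dE: "d \<in> E" and dX: "d \<in> X" using d(1) SK(2)[OF k] E_X by blast+

    define N1 where "N1 = {m\<in>N. N.le m0 m}"
    have N1: "N.unbounded N1"
      unfolding N.unbounded_def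
    proof (intro conjI ballI)
      fix x assume "x \<in> N"
      then obtain y where "y \<in> N" "ltN x y" "ltN m0 y"
        using N.X_fin_bound[of "{x, m0}"] m0(1) by auto
      then show "\<exists>y\<in>N1. ltN x y" unfolding N1_def by blast
    qed (auto simp: N1_def)
    have "\<exists>v th e. P m v th e \<and> d \<prec> v \<and> e \<preceq> h0 m" if "m \<in> N1" for m
      using h0(2)[OF _ dX] that unfolding N1_def by blast
    then obtain v th e where vt: "\<And>m. m \<in> N1 \<Longrightarrow> P m (v m) (th m) (e m) \<and> d \<prec> v m \<and> e m \<preceq> h0 m"
      by metis
    \<comment> \<open>The letters before \<open>th m\<close> are below \<open>m0\<close>, hence
      below \<open>m\<close>, which occurs at \<open>v m\<close>. So all words from
      \<open>b (th m)\<close> to \<open>d\<close> have the same maximum \<open>W m\<close>.\<close>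
    define W where "W m = word_max ltN (word f (th m) d)" for m
    have top: "d \<prec> j" "word_max ltN (word f j d) = W m" if m: "m \<in> N1" and j: "j \<in> b (th m)" for m j
    proof -
      note v = vt[OF m, unfolded P_def]
      have mN: "m \<in> N" "N.le m0 m" using m unfolding N1_def by blast+
      have thE: "th m \<in> E" "al (th m) = m0" using v unfolding E0_def by blast+
      have "h0 m \<prec> d" using hs(2)[OF mN(1)] d(3) trans by blast
      then have ed: "e m \<prec> d" using v le_lt by blast
      then have e0d: "e0 (th m) \<preceq> d" using v le_lt by blast
      have dth: "d \<prec> th m" using v trans by blast
      then show dj: "d \<prec> j" using j ab thE(1) E_X trans by blast
      have w1: "word f j d = word f j (th m) @ word f (th m) d"
        using word_near[OF e0(2)[OF thE(1) j] e0d dth] .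
      have w2: "word f (th m) d = word f (th m) (v m) @ word f (v m) d"
        using word_near[of "th m" "v m" "e m" d] v ed by blast
      have "h (v m) = m" using SN(3)[OF mN(1)] v by blast
      then have "m \<in> set (word f (v m) d)"
        using word_step[of d "v m" f] v unfolding f_def by (metis list.set_intros(1))
      then have mW: "m \<in> set (word f (th m) d)" using w2 by simp
      then have ne: "word f (th m) d \<noteq> []" by auto
      have WW: "W m \<in> set (word f (th m) d)" "\<forall>y\<in>set (word f (th m) d). N.le y (W m)"
        unfolding W_def using N.word_max[OF ne wordN] by blast+
      have "ltN y (W m)" if "y \<in> set (word f j (th m))" for y
      proof -
        have "ltN y m0" using that al(3)[OF thE(1) j] thE(2) unfolding word_h by auto
        then show ?thesis using mN(2) WW(2) mW N.lt_le by blast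
      qed
      with WW w1 show "word_max ltN (word f j d) = W m"
        by (intro N.word_max_eqI[OF wordN]) auto
    qed
    have W: "W m \<in> N" "N.le m (W m)" if m: "m \<in> N1" for m
    proof -
      note v = vt[OF m, unfolded P_def]
      have mN: "m \<in> N" using m unfolding N1_def by blast
      have ed: "e m \<preceq> d" using v hs(2)[OF mN] d(3) le_lt trans by blast
      have w2: "word f (th m) d = word f (th m) (v m) @ word f (v m) d"
        using word_near[of "th m" "v m" "e m" d] v ed by blast
      have "h (v m) = m" using SN(3)[OF mN(1)] v by blast
      then have "m \<in> set (word f (v m) d)"
        using word_step[of d "v m" f] v unfolding f_def by (metis list.set_intros(1))
      then have mW: "m \<in> set (word f (th m) d)" using w2 by simp
      then have ne: "word f (th m) d \<noteq> []" by auto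
      show "W m \<in> N" "N.le m (W m)"
        unfolding W_def using N.word_max[OF ne wordN] mW wordN by blast+
    qed
    have thX: "th m \<in> X" if "m \<in> N1" for m
      using vt[OF that] E0(2) E_X unfolding P_def by blast
    have "\<exists>e. e \<prec> d \<and> (\<forall>j\<in>b (th m). near j d e)" if m: "m \<in> N1" for m
      using near_ex[OF dE, of "b (th m)"] top(1)[OF m] ab thX[OF m] by metis
    then obtain e2 where e2: "\<And>m. m \<in> N1 \<Longrightarrow> e2 m \<prec> d"
      "\<And>m j. m \<in> N1 \<Longrightarrow> j \<in> b (th m) \<Longrightarrow> near j d (e2 m)"
      by metis
    have "|N1| <o |L|" using small_subset[OF _ N(2), of N1] unfolding N1_def by blast
    then obtain x0 where x0: "x0 \<prec> d" "\<forall>m\<in>N1. e2 m \<prec> x0"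
      using E_bound[OF dE, of N1 e2] e2(1) by blast

    have obound: "\<exists>n::nat. \<forall>x\<in>Z. \<forall>y\<in>Z. ob x y < n" if "finite Z" for Z
    proof -
      have "finite ((\<lambda>(x, y). ob x y) ` (Z \<times> Z))" using that by blast
      then obtain n where "\<forall>c\<in>(\<lambda>(x, y). ob x y) ` (Z \<times> Z). c < n"
        using finite_nat_set_iff_bounded by auto
      then show ?thesis by auto
    qed
    have "\<exists>n. \<forall>j\<in>b (th m). \<forall>x\<in>set (word f j d). \<forall>y\<in>set (word f j d). ob x y < n" if m: "m \<in> N1" for m
      using obound[of "\<Union>j\<in>b (th m). set (word f j d)"] ab thX[OF m] by fastforce
    then obtain nb where nb: "\<And>m j x y. m \<in> N1 \<Longrightarrow> j \<in> b (th m) \<Longrightarrow> x \<in> set (word f j d) \<Longrightarrow>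
        y \<in> set (word f j d) \<Longrightarrow> ob x y < nb m"
      by metis
    \<comment> \<open>Claims are natural numbers, so one bound on the claims above \<open>d\<close>
      serves unboundedly many \<open>m\<close>.\<close>
    obtain n1 where n1: "N.unbounded {m\<in>N1. nb m = n1}"
      using N.X_pigeonhole[where F = nb, OF N1 N.le_countable] by blast

    define c where "c m = gm m x0" for m
    have x0X: "x0 \<in> X" using x0(1) dom(1) by blast
    have c: "c m \<in> S (Inl m)" "c m \<in> E" "club_pt ga (c m)" "x0 \<prec> c m" "c m \<prec> d" if m: "m \<in> N" for m
    proof -
      show "c m \<in> S (Inl m)" "club_pt ga (c m)" "x0 \<prec> c m"
        using gm[OF m x0X] unfolding c_def by blast+
      then show "c m \<in> E" using SN(2)[OF m] by blast
      have "g x0 \<prec> d" using d(2) x0(1) unfolding club_pt_def by blast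
      then show "c m \<prec> d" using g[OF x0X] m trans unfolding c_def by blast
    qed
    have "\<exists>x. x \<prec> c m \<and> x0 \<preceq> x \<and> near d (c m) x" if m: "m \<in> N" for m
    proof -
      obtain e4 where e4: "e4 \<prec> c m" "near d (c m) e4"
        using near_ex1[OF c(2,5)[OF m]] by blast
      obtain x1 where "x1 \<prec> c m" "x0 \<preceq> x1" "e4 \<preceq> x1"
        using E_fin_bound[OF c(2)[OF m], of "{x0, e4}"] c(4)[OF m] e4(1) by auto
      with near_mono[OF e4(2)] show ?thesis by blast
    qed
    then obtain x1 where x1: "\<And>m. m \<in> N \<Longrightarrow> x1 m \<prec> c m" "\<And>m. m \<in> N \<Longrightarrow> x0 \<preceq> x1 m"
      "\<And>m. m \<in> N \<Longrightarrow> near d (c m) (x1 m)"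
      by metis
    have x1X: "x1 m \<in> X" if "m \<in> N" for m using x1(1)[OF that] dom(1) by blast
    have ai: "x1 m \<prec> i" "i \<prec> c m" "i \<prec> d" if m: "m \<in> N" and i: "i \<in> a (x1 m)" for i m
    proof -
      show "x1 m \<prec> i" using ab x1X[OF m] i by blast
      have "ga (x1 m) \<prec> c m" using c(3)[OF m] x1(1)[OF m] unfolding club_pt_def by blast
      then show "i \<prec> c m" using ga[OF x1X[OF m]] i trans by blast
      then show "i \<prec> d" using c(5)[OF m] trans by blast
    qed
    \<comment> \<open>The part of the word below \<open>d\<close> that does not depend on the end
      point in \<open>a (x1 m)\<close>; its last letter is \<open>m\<close>.\<close>
    define cw where "cw m = word f d (c m) @ [m]" for m
    have wlow: "word f d i = cw m @ tl (word f (c m) i)" if m: "m \<in> N" and i: "i \<in> a (x1 m)" for i m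
    proof -
      have "word f d i = word f d (c m) @ word f (c m) i"
        using word_near[OF x1(3)[OF m]] ai[OF m i] by blast
      moreover have "word f (c m) i = m # tl (word f (c m) i)"
        using word_step[OF ai(2)[OF m i], of f] SN(3)[OF m c(1)[OF m]] unfolding f_def by simp
      ultimately show ?thesis unfolding cw_def by simp
    qed
    have "\<exists>n. \<forall>i\<in>a (x1 m). \<forall>x\<in>set (word f d i). \<forall>y\<in>set (word f d i). ob x y < n" if m: "m \<in> N" for m
      using obound[of "\<Union>i\<in>a (x1 m). set (word f d i)"] ab x1X[OF m] by fastforce
    then obtain nc where nc: "\<And>m i x y. m \<in> N \<Longrightarrow> i \<in> a (x1 m) \<Longrightarrow> x \<in> set (word f d i) \<Longrightarrow>
        y \<in> set (word f d i) \<Longrightarrow> ob x y < nc m"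
      by metis
    \<comment> \<open>Only countably many pairs of word length and claim bound occur, so one pair
      serves unboundedly many \<open>m\<close>.\<close>
    obtain z where z: "N.unbounded {m\<in>N. prod_encode (length (cw m), nc m) = z}"
      using N.X_pigeonhole[where F = "\<lambda>m. prod_encode (length (cw m), nc m)", OF N.X_unbounded N.le_countable]
      by blast
    define B0 where "B0 = {m\<in>N. prod_encode (length (cw m), nc m) = z}"
    obtain l n2 where "prod_decode z = (l, n2)" by (cases "prod_decode z") auto
    then have B0: "m \<in> N \<and> length (cw m) = l \<and> nc m = n2" if "m \<in> B0" for m
      using that unfolding B0_def by (metis (mono_tags, lifting) Pair_inject mem_Collect_eq prod_encode_inverse)
    have cwN: "set (cw m) \<subseteq> N \<and> m \<in> set (cw m) \<and> length (cw m) = l" if "m \<in> B0" for m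
      using B0[OF that] wordN unfolding cw_def by auto
    \<comment> \<open>\<open>s\<close> stays fixed while the letter after it ranges over an
      unbounded set; its length is the shift to be encoded.\<close>
    obtain s where s: "\<And>x. x \<in> N \<Longrightarrow> \<exists>y\<in>B0. \<exists>q u. cw y = s @ q # u \<and> ltN x q"
      using N.common_prefix[OF z[folded B0_def], of cw l] cwN by metis
    have sN: "set s \<subseteq> N"
      using s[OF n0] cwN by fastforce
    define B where "B = {q. \<exists>y\<in>B0. \<exists>u. cw y = s @ q # u}"
    have "N.unbounded B"
      unfolding N.unbounded_def B_def using s cwN by fastforce
    moreover define A where "A = {W m |m. m \<in> N1 \<and> nb m = n1 \<and> (\<forall>y\<in>set s. ltN y (W m))}"
    have "N.unbounded A"
      unfolding N.unbounded_def
    proof (intro conjI ballI)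
      show "A \<subseteq> N" unfolding A_def using W(1) by blast
      fix x assume "x \<in> N"
      then obtain y where y: "y \<in> N" "\<forall>z\<in>insert x (set s). ltN z y"
        using N.X_fin_bound[of "insert x (set s)"] sN by auto
      then obtain m where m: "m \<in> N1" "nb m = n1" "ltN y m"
        using n1 unfolding N.unbounded_def by blast
      then have "ltN z (W m)" if "z \<in> insert x (set s)" for z
        using y(2) W(2)[OF m(1)] that N.trans N.lt_le by blast
      then show "\<exists>a\<in>A. ltN x a" unfolding A_def using m by blast
    qed
    \<comment> \<open>The code is at least \<open>max n1 n2\<close>, which beats all other claims,
      and its second component recovers the shift.\<close>
    ultimately obtain w q where wq: "w \<in> A" "q \<in> B" "ltN w q" "ob w q = prod_encode (max n1 n2, length s)"
      using ob by metis
    obtain m where m: "m \<in> N1" "nb m = n1" "w = W m" "\<And>y. y \<in> set s \<Longrightarrow> ltN y w"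
      using wq(1) unfolding A_def by blast
    obtain n u where n: "n \<in> B0" "cw n = s @ q # u"
      using wq(2) unfolding B_def by blast
    have nN: "n \<in> N" using B0[OF n(1)] by blast
    have big: "c < n1 \<Longrightarrow> c < ob w q" "c < n2 \<Longrightarrow> c < ob w q" for c
      using le_prod_encode_1[of "max n1 n2" "length s"] wq(4) by auto
    have main: "i \<prec> j \<and> p i j = k" if i: "i \<in> a (x1 n)" and j: "j \<in> b (th m)" for i j
    proof
      note dj = top[OF m(1) j]
      note ii = ai[OF nN i]
      show "i \<prec> j" using ii(3) dj(1) trans by blast
      have "e2 m \<preceq> i"
        using x0(2) m(1) x1(2)[OF nN] ii(1) lt_le trans by blast
      then have nr: "word f j i = word f j d @ word f d i" "walk j i = walk j d @ walk d i"
        using word_near walk_near e2(2)[OF m(1) j] ii(3) by blast+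
      let ?u = "u @ tl (word f (c n) i)"
      have wd: "word f d i = s @ q # ?u"
        using wlow[OF nN i] n(2) by simp
      have Wj: "word_max ltN (word f j d) = w" using dj(2) m(3) by simp
      have "split_pos ltN ob (<) off (word f j d @ s @ q # ?u) = length (word f j d)"
      proof (rule split_pos_eq)
        show "word f j d \<noteq> []" using word_step[OF dj(1), of f] by auto
        show "\<forall>y\<in>set s. \<not> ltN (word_max ltN (word f j d)) y"
          unfolding Wj using m(4) N.asym by blast
        show "ltN (word_max ltN (word f j d)) q" unfolding Wj by (rule wq(3))
        show "off (ob (word_max ltN (word f j d)) q) = length s"
          unfolding Wj wq(4) off_def by simp
        show "c < ob (word_max ltN (word f j d)) q" if "Some c \<in> set (claims ltN ob (word f j d))" for c
          using claims_set[OF that] nb[OF m(1) j] m(2) unfolding Wj by (intro big(1)) auto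
        show "c < ob (word_max ltN (word f j d)) q" if "Some c \<in> set (claims_from ltN ob q ?u)" for c
          using claims_from_set[OF that] nc[OF nN i] B0[OF n(1)] unfolding Wj wd by (intro big(2)) auto
      qed simp
      then have "split_pos ltN ob (<) off (word f j i) = length (walk j d)"
        using nr(1) wd by (simp add: word_def)
      then have "walk j i ! split_pos ltN ob (<) off (word f j i) = d"
        using nr(2) walk_step[OF ii(3)] by (simp add: nth_append)
      then show "p i j = k"
        unfolding p_def using SK(3)[OF k d(1)] by simp
    qed
    show "\<exists>x\<in>X. \<exists>y\<in>X. \<forall>i\<in>a x. \<forall>j\<in>b y. i \<prec> j \<and> p i j = k"
      using main x1X[OF nN] thX[OF m(1)] by blast
  qed
  then show ?thesis by blast
qed

end

section \<open>From cardinal well-orders to rich colourings\<close>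

abbreviation strict :: "'a rel \<Rightarrow> 'a \<Rightarrow> 'a \<Rightarrow> bool"
  where "strict r x y \<equiv> (x, y) \<in> r \<and> x \<noteq> y"

lemma underS_strict: "{x. strict r x y} = underS r y"
  unfolding underS_def by auto

lemma Well_order_wo_set:
  assumes "Well_order r"
  shows "wo_set (Field r) (strict r)"
proof
  have r: "wf (r - Id)" "Linear_order r"
    using assms unfolding well_order_on_def by auto
  have "{(x, y). strict r x y} = r - Id" by auto
  then show "wf {(x, y). strict r x y}" using r(1) by simp
  show "strict r x z" if "strict r x y" "strict r y z" for x y z
    using that r(2) unfolding linear_order_on_def partial_order_on_def preorder_on_def
    by (metis antisymD transE)
  show "strict r x y \<or> x = y \<or> strict r y x" if "x \<in> Field r" "y \<in> Field r" for x y
    using that r(2) unfolding linear_order_on_def total_on_def by blast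
  show "x \<in> Field r" "y \<in> Field r" if "strict r x y" for x y
    using that by (auto intro: FieldI1 FieldI2)
qed

text \<open>Regularity of \<open>cardSuc r\<close> gives the bounds in \<open>X\<close>: a set of
  size at most \<open>|Field r|\<close> is not cofinal, and one more step up makes its bound
  strict.\<close>

lemma cardSuc_succ_card:
  assumes r: "Card_order r" "infinite (Field r)" "regularCard r"
  shows "succ_card (Field (cardSuc r)) (strict (cardSuc r)) (Field r) (strict r)"
proof -
  let ?s = "cardSuc r"
  have s: "Card_order ?s" "infinite (Field ?s)"
    using r cardSuc_Card_order cardSuc_finite by blast+
  have iso: "|Field r| =o r" "|Field ?s| =o ?s"
    using card_of_Field_ordIso r(1) s(1) by blast+
  interpret wo_set "Field ?s" "strict ?s"
    using s(1) by (intro Well_order_wo_set) (auto simp: card_order_on_def)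
  interpret L: wo_set "Field r" "strict r"
    using r(1) by (intro Well_order_wo_set) (auto simp: card_order_on_def)
  show ?thesis
  proof
    show "|{k. strict r k l}| <o |Field r|" if "l \<in> Field r" for l
      unfolding underS_strict
      using card_of_underS[OF r(1) that] iso(1) ordIso_symmetric ordLess_ordIso_trans by blast
    show "stable |Field r|"
      using stable_ordIso1[OF regularCard_stable[OF r] iso(1)] .
    show "infinite (Field r)" by (rule r(2))
    show "|{y. strict ?s y x}| \<le>o |Field r|" if x: "x \<in> Field ?s" for x
    proof -
      have "|underS ?s x| \<le>o r"
        using card_of_underS[OF s(1) x] cardSuc_ordLeq_ordLess[OF r(1) card_of_Card_order] by blast
      then show ?thesis
        unfolding underS_strict using iso(1) ordIso_symmetric ordLeq_ordIso_trans by blast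
    qed
    show "\<exists>x\<in>Field ?s. \<forall>a\<in>A. strict ?s a x" if A: "A \<subseteq> Field ?s" "|A| \<le>o |Field r|" for A
    proof -
      have "|A| \<le>o r" using A(2) iso(1) ordLeq_ordIso_trans by blast
      then have "|A| <o ?s"
        using cardSuc_ordLeq_ordLess[OF r(1) card_of_Card_order] by blast
      then have "\<not> |A| =o ?s" using not_ordLess_ordIso by blast
      then have "\<not> cofinal A ?s"
        using infinite_cardSuc_regularCard[OF r(2,1)] A(1) unfolding regularCard_def by blast
      then obtain x where x: "x \<in> Field ?s" "\<forall>a\<in>A. \<not> strict ?s x a"
        unfolding cofinal_def by blast
      obtain y where y: "y \<in> Field ?s" "strict ?s x y"
        using infinite_Card_order_limit[OF s x(1)] by blast
      have "strict ?s a y" if "a \<in> A" for a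
        using total[of a x] x that A(1) y(2) trans[of a x y] by blast
      with y(1) show ?thesis by blast
    qed
  qed
qed

lemma rich_cardSuc_successor:
  fixes r :: "'a rel" and M :: "'m set" and K :: "'x set"
  assumes r: "Card_order r" "infinite (Field r)" "regularCard r"
    and M: "infinite M" "|M| <o |Field r|" "\<And>A::'a set. |A| <o |Field r| \<Longrightarrow> |A| \<le>o |M|"
    and K: "|K| \<le>o |Field r|"
  shows "\<exists>p. succ_card.rich (Field (cardSuc r)) (strict (cardSuc r)) K p"
proof (rule succ_card.rich_succ[OF cardSuc_succ_card[OF r] _ M(2) _ _ _ M(3) K])
  show "wo_set M (strict |M| )"
    using Well_order_wo_set[OF card_of_Well_order[of M]] by (simp add: Field_card_of)
  show "|{n. strict |M| n m}| <o |M|" if "m \<in> M" for m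
    unfolding underS_strict
    using card_of_underS[OF card_of_Card_order[of M]] that by (simp add: Field_card_of)
  show "\<exists>n\<in>M. strict |M| m n" if "m \<in> M" for m
    using infinite_Card_order_limit[OF card_of_Card_order[of M]] M(1) that by (auto simp: Field_card_of)
  show "M \<noteq> {}" using M(1) by auto
qed

lemma cardSuc_natLeq:
  shows "Card_order (cardSuc natLeq)" "infinite (Field (cardSuc natLeq))" "regularCard (cardSuc natLeq)"
proof -
  show 1: "infinite (Field (cardSuc natLeq))"
    using cardSuc_finite[OF natLeq_Card_order] by (simp add: Field_natLeq)
  show "Card_order (cardSuc natLeq)"
    by (rule cardSuc_Card_order[OF natLeq_Card_order])
  show "regularCard (cardSuc natLeq)"
    by (rule infinite_cardSuc_regularCard[OF _ natLeq_Card_order]) (simp add: Field_natLeq)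
qed

text \<open>The successor case for \<open>\<omega>\<^sub>1\<close> with all natural numbers as
  colours; richness is applied to singletons taken from \<open>A\<close> and
  \<open>B\<close>.\<close>

lemma omega2_colouring:
  fixes N defines "N \<equiv> Field (cardSuc (cardSuc natLeq))"
  obtains ob :: "nat set set \<Rightarrow> nat set set \<Rightarrow> nat"
  where "\<And>A B n. wo_set.unbounded N (strict (cardSuc (cardSuc natLeq))) A \<Longrightarrow>
    wo_set.unbounded N (strict (cardSuc (cardSuc natLeq))) B \<Longrightarrow>
    \<exists>x\<in>A. \<exists>y\<in>B. strict (cardSuc (cardSuc natLeq)) x y \<and> ob x y = n"
proof -
  let ?r = "cardSuc natLeq" and ?lt = "strict (cardSuc (cardSuc natLeq))"
  interpret S: succ_card N ?lt "Field ?r" "strict ?r"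
    unfolding N_def by (rule cardSuc_succ_card[OF cardSuc_natLeq])
  have r: "|Field ?r| =o ?r"
    by (rule card_of_Field_ordIso[OF cardSuc_natLeq(1)])
  have nat: "|UNIV::nat set| =o natLeq"
    using card_of_nat by blast
  have "|UNIV::nat set| <o ?r"
    using nat cardSuc_greater[OF natLeq_Card_order] ordIso_ordLess_trans by blast
  then have lt: "|UNIV::nat set| <o |Field ?r|"
    using r ordIso_symmetric ordLess_ordIso_trans by blast
  have le: "|A| \<le>o |UNIV::nat set|" if "|A| <o |Field ?r|" for A :: "nat set set"
  proof -
    have "|A| <o ?r" using that r ordLess_ordIso_trans by blast
    then have "|A| \<le>o natLeq"
      using cardSuc_ordLeq_ordLess[OF natLeq_Card_order card_of_Card_order] by blast
    then show ?thesis using nat ordIso_symmetric ordLeq_ordIso_trans by blast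
  qed
  have "\<exists>p::nat set set \<Rightarrow> nat set set \<Rightarrow> nat. S.rich UNIV p"
    unfolding N_def
    by (rule rich_cardSuc_successor[OF cardSuc_natLeq _ lt le ordLess_imp_ordLeq[OF lt]]) auto
  then obtain ob :: "nat set set \<Rightarrow> nat set set \<Rightarrow> nat" where ob: "S.rich UNIV ob" ..
  show ?thesis
  proof
    fix A B n assume AB: "S.unbounded A" "S.unbounded B"
    then obtain f g where fg: "\<And>x. x \<in> N \<Longrightarrow> f x \<in> A \<and> ?lt x (f x)" "\<And>x. x \<in> N \<Longrightarrow> g x \<in> B \<and> ?lt x (g x)"
      unfolding S.unbounded_def by metis
    have "\<forall>x\<in>N. finite {f x} \<and> finite {g x} \<and> (\<forall>i\<in>{f x} \<union> {g x}. ?lt x i)"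
      using fg by simp
    then have "\<exists>x\<in>N. \<exists>y\<in>N. \<forall>i\<in>{f x}. \<forall>j\<in>{g y}. ?lt i j \<and> ob i j = n"
      using ob[unfolded S.rich_def, THEN bspec, of n, THEN spec, of "\<lambda>x. {f x}", THEN spec, of "\<lambda>x. {g x}"]
      by simp
    then obtain x y where xy: "x \<in> N" "y \<in> N" "?lt (f x) (g y) \<and> ob (f x) (g y) = n"
      by auto
    then show "\<exists>x\<in>A. \<exists>y\<in>B. ?lt x y \<and> ob x y = n"
      using fg(1)[OF xy(1)] fg(2)[OF xy(2)] by (intro bexI[of _ "f x"] bexI[of _ "g y"]) auto
  qed
qed

text \<open>Either there is a largest cardinal below \<open>r\<close>, and the successor case
  applies, or two further cardinals fit between \<omega> and \<open>r\<close>. Then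
  \<open>\<omega>\<^sub>2\<close> is below \<open>r\<close>, as the limit case requires.\<close>

lemma rich_cardSuc:
  fixes r :: "'a rel" and K :: "'x set"
  assumes r: "Card_order r" "natLeq <o r" "regularCard r" and K: "|K| \<le>o |Field r|"
  shows "\<exists>p. succ_card.rich (Field (cardSuc r)) (strict (cardSuc r)) K p"
proof -
  have iso: "|Field r| =o r" using card_of_Field_ordIso r(1) by blast
  have nat: "|UNIV::nat set| <o |Field r|"
    using r(2) iso card_of_nat ordIso_ordLess_trans ordIso_symmetric ordLess_ordIso_trans by metis
  then have inf: "infinite (Field r)"
    using infinite_iff_card_of_nat ordLess_imp_ordLeq by blast
  show ?thesis
  proof (cases "\<exists>M::'a set. |M| <o |Field r| \<and> (\<forall>A::'a set. |A| <o |Field r| \<longrightarrow> |A| \<le>o |M| )")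
    case True
    then obtain M :: "'a set" where M: "|M| <o |Field r|" "\<And>A::'a set. |A| <o |Field r| \<Longrightarrow> |A| \<le>o |M|"
      by blast
    obtain B :: "'a set" where B: "|UNIV::nat set| =o |B|" "|B| <o |Field r|"
      using nat internalize_card_of_ordLess[of "UNIV::nat set" "|Field r|"] by blast
    then have "|UNIV::nat set| \<le>o |M|"
      using M(2) ordIso_ordLeq_trans by blast
    then have "infinite M" using infinite_iff_card_of_nat by blast
    with M K show ?thesis
      by (intro rich_cardSuc_successor[OF r(1) inf r(3)]) auto
  next
    case False
    then have step: "\<exists>A::'a set. |A| <o |Field r| \<and> |M| <o |A|" if "|M| <o |Field r|" for M :: "'a set"
      using that card_of_Well_order not_ordLess_iff_ordLeq by metis
    obtain B :: "'a set" where B: "|UNIV::nat set| =o |B|" "|B| <o |Field r|"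
      using nat internalize_card_of_ordLess[of "UNIV::nat set" "|Field r|"] by blast
    obtain A1 A2 :: "'a set" where A: "|B| <o |A1|" "|A1| <o |A2|" "|A2| <o |Field r|"
      using step B(2) by metis
    have "natLeq <o |A1|"
      using A(1) B(1) card_of_nat ordIso_ordLess_trans ordIso_symmetric by metis
    then have "cardSuc natLeq \<le>o |A1|"
      using cardSuc_least[OF natLeq_Card_order card_of_Card_order] by blast
    then have "cardSuc natLeq <o |A2|" using A(2) ordLeq_ordLess_trans by blast
    then have "cardSuc (cardSuc natLeq) \<le>o |A2|"
      using cardSuc_least[OF cardSuc_natLeq(1) card_of_Card_order] by blast
    then have "cardSuc (cardSuc natLeq) <o |Field r|" using A(3) ordLeq_ordLess_trans by blast
    then have N: "|Field (cardSuc (cardSuc natLeq))| <o |Field r|"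
      using card_of_Field_ordIso[OF cardSuc_Card_order[OF cardSuc_natLeq(1)]] ordIso_ordLess_trans by blast
    obtain ob :: "nat set set \<Rightarrow> nat set set \<Rightarrow> nat"
      where ob: "\<And>A B n. wo_set.unbounded (Field (cardSuc (cardSuc natLeq))) (strict (cardSuc (cardSuc natLeq))) A \<Longrightarrow>
        wo_set.unbounded (Field (cardSuc (cardSuc natLeq))) (strict (cardSuc (cardSuc natLeq))) B \<Longrightarrow>
        \<exists>x\<in>A. \<exists>y\<in>B. strict (cardSuc (cardSuc natLeq)) x y \<and> ob x y = n"
      using omega2_colouring by blast
    show ?thesis
      by (rule succ_card.rich_limit[OF cardSuc_succ_card[OF r(1) inf r(3)]
            cardSuc_succ_card[OF cardSuc_natLeq] N ob K])
  qed
qed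

section \<open>The bilinear form\<close>

definition fscale :: "'f::field \<Rightarrow> ('i \<Rightarrow> 'f) \<Rightarrow> ('i \<Rightarrow> 'f)"
  where "fscale c v = (\<lambda>i. c * v i)"

lemma fscale_apply [simp]: "fscale c v i = c * v i"
  by (simp add: fscale_def)

interpretation fs: vector_space fscale
  by unfold_locales (auto simp: fun_eq_iff algebra_simps)

lemma sum_fun_apply: "(\<Sum>x\<in>A. f x) i = (\<Sum>x\<in>A. f x i :: 'f::field)"
  by (induction A rule: infinite_finite_induct) auto

definition supp :: "('i \<Rightarrow> 'f::zero) \<Rightarrow> 'i set"
  where "supp v = {i. v i \<noteq> 0}"

definition fin_fun :: "'i set \<Rightarrow> ('i \<Rightarrow> 'f::field) set"
  where "fin_fun Y = {v. finite (supp v) \<and> supp v \<subseteq> Y}"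

definition unit :: "'i \<Rightarrow> 'i \<Rightarrow> 'f::field"
  where "unit i = (\<lambda>j. if j = i then 1 else 0)"

lemma supp_add: "supp (v + w) \<subseteq> supp v \<union> supp (w :: 'i \<Rightarrow> 'f::field)"
  unfolding supp_def by auto

lemma supp_fscale: "supp (fscale c v) \<subseteq> supp v"
  unfolding supp_def by auto

lemma subspace_fin_fun: "fs.subspace (fin_fun Y :: ('i \<Rightarrow> 'f::field) set)"
  unfolding fs.subspace_def
proof (intro conjI ballI allI)
  show "(0 :: 'i \<Rightarrow> 'f) \<in> fin_fun Y" by (simp add: fin_fun_def supp_def)
  show "v + w \<in> fin_fun Y" if "v \<in> fin_fun Y" "w \<in> fin_fun Y" for v w :: "'i \<Rightarrow> 'f"
    using that supp_add[of v w] finite_subset[OF supp_add[of v w]] unfolding fin_fun_def by auto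
  show "fscale c v \<in> fin_fun Y" if "v \<in> fin_fun Y" for c and v :: "'i \<Rightarrow> 'f"
    using that supp_fscale[of c v] finite_subset[OF supp_fscale[of c v]] unfolding fin_fun_def by auto
qed

lemma span_unit: "fs.span (unit ` Y) = (fin_fun Y :: ('i \<Rightarrow> 'f::field) set)"
proof
  have "unit ` Y \<subseteq> (fin_fun Y :: ('i \<Rightarrow> 'f) set)"
    by (auto simp: fin_fun_def supp_def unit_def split: if_splits)
  then show "fs.span (unit ` Y) \<subseteq> (fin_fun Y :: ('i \<Rightarrow> 'f) set)"
    using fs.span_minimal subspace_fin_fun by blast
  show "fin_fun Y \<subseteq> fs.span (unit ` Y :: ('i \<Rightarrow> 'f) set)"
  proof
    fix v :: "'i \<Rightarrow> 'f" assume v: "v \<in> fin_fun Y"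
    have "v = (\<Sum>i\<in>supp v. fscale (v i) (unit i))"
      using v by (auto simp: fun_eq_iff sum_fun_apply unit_def fin_fun_def supp_def
          if_distrib[of "(*) _"] cong: if_cong)
    moreover have "(\<Sum>i\<in>supp v. fscale (v i) (unit i)) \<in> fs.span (unit ` Y)"
      using v by (intro fs.span_sum fs.span_scale fs.span_base) (auto simp: fin_fun_def)
    ultimately show "v \<in> fs.span (unit ` Y)" by simp
  qed
qed

lemma inj_unit: "inj (unit :: 'i \<Rightarrow> 'i \<Rightarrow> 'f::field)"
  by (rule injI) (auto simp: unit_def fun_eq_iff split: if_splits)

lemma independent_unit: "fs.independent (unit ` Y :: ('i \<Rightarrow> 'f::field) set)"
proof
  assume "fs.dependent (unit ` Y :: ('i \<Rightarrow> 'f) set)"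
  then obtain t :: "('i \<Rightarrow> 'f) set" and u w where t: "finite t" "t \<subseteq> unit ` Y"
    "(\<Sum>v\<in>t. fscale (u v) v) = 0" "w \<in> t" "u w \<noteq> 0"
    unfolding fs.dependent_explicit by blast
  obtain i where i: "w = unit i" using t(2,4) by blast
  have "u v * v i = (if v = w then u w else 0)" if v: "v \<in> t" for v
  proof -
    obtain j where "v = unit j" using t(2) v by blast
    then show ?thesis using i inj_unit[THEN injD, of j i] by (auto simp: unit_def)
  qed
  then have "(\<Sum>v\<in>t. u v * v i) = (\<Sum>v\<in>t. if v = w then u w else 0)"
    by (intro sum.cong) auto
  moreover have "(\<Sum>v\<in>t. u v * v i) = 0"
    using fun_cong[OF t(3), of i] by (simp add: sum_fun_apply)
  ultimately show False using t(1,4,5) by simp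
qed

lemma cdim_fin_fun: "fs.cdim (fin_fun Y :: ('i \<Rightarrow> 'f::field) set) =o |Y|"
proof -
  have "fs.span (unit ` Y) = fs.span (fin_fun Y :: ('i \<Rightarrow> 'f) set)"
    unfolding span_unit by (rule fs.span_eq_iff[THEN iffD2, OF subspace_fin_fun, symmetric])
  then have "|unit ` Y :: ('i \<Rightarrow> 'f) set| =o fs.cdim (fin_fun Y :: ('i \<Rightarrow> 'f) set)"
    by (rule fs.card_of_basis_ordIso_cdim[OF independent_unit])
  moreover have "bij_betw unit Y (unit ` Y :: ('i \<Rightarrow> 'f) set)"
    by (rule bij_betw_imageI[OF inj_on_subset[OF inj_unit subset_UNIV] refl])
  then have "|Y| =o |unit ` Y :: ('i \<Rightarrow> 'f) set|"
    using card_of_ordIso by blast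
  ultimately show ?thesis
    using ordIso_symmetric ordIso_transitive by blast
qed

lemma (in vector_space) basis_of_subspace:
  assumes "subspace V"
  obtains B where "independent B" "span B = V" "|B| =o cdim V"
proof -
  obtain B where "B \<subseteq> V" "independent B" "V \<subseteq> span B"
    using maximal_independent_subset by blast
  then have B: "independent B" "span B = V"
    using assms span_minimal by blast+
  then have "span B = span V" using assms by (metis span_eq_iff)
  with B that card_of_basis_ordIso_cdim show ?thesis by blast
qed

lemma (in vector_space) independent_le_cdim:
  assumes "subspace V" "B \<subseteq> V" "independent B"
  shows "|B| \<le>o cdim V"
proof -
  obtain C where C: "B \<subseteq> C" "C \<subseteq> V" "independent C" "V \<subseteq> span C"
    using maximal_independent_subset_extend[OF assms(2,3)] by blast
  then have "span C = V" using assms(1) span_minimal by blast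
  then have "span C = span V" using assms(1) by (metis span_eq_iff)
  then have "|C| =o cdim V" using C(3) card_of_basis_ordIso_cdim by blast
  then show ?thesis using card_of_mono1[OF C(1)] ordLeq_ordIso_trans by blast
qed

text \<open>Restriction to \<open>Y\<close> maps \<open>V\<close> linearly into a space of dimension
  \<open>|Y|\<close>. If it were injective on \<open>V\<close>, a basis of \<open>V\<close> would
  become an independent set too large for that space.\<close>

lemma vanishing_vector:
  fixes V :: "('i \<Rightarrow> 'f::field) set"
  assumes V: "fs.subspace V" "V \<subseteq> fin_fun X" and Y: "|Y| <o fs.cdim V"
  obtains v where "v \<in> V" "v \<noteq> 0" "supp v \<inter> Y = {}"
proof -
  define R where "R v = (\<lambda>i. if i \<in> Y then v i else 0)" for v :: "'i \<Rightarrow> 'f"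
  interpret R: module_hom fscale fscale R
    by unfold_locales (auto simp: R_def fun_eq_iff algebra_simps)
  have "\<exists>v\<in>V. v \<noteq> 0 \<and> R v = 0"
  proof (rule ccontr)
    assume neg: "\<not> ?thesis"
    obtain B where B: "fs.independent B" "fs.span B = V" "|B| =o fs.cdim V"
      using fs.basis_of_subspace[OF V(1)] by blast
    have inj: "inj_on R V"
    proof (rule inj_onI)
      fix v w assume vw: "v \<in> V" "w \<in> V" "R v = R w"
      then have "R (v - w) = 0" by (simp add: R.diff)
      moreover have "v - w \<in> V" using vw V(1) fs.subspace_diff by blast
      ultimately show "v = w" using neg by auto
    qed
    then have ind: "fs.independent (R ` B)"
      using B(1,2) by (intro R.independent_injective_image) auto
    have BV: "B \<subseteq> V" using B(2) fs.span_superset by blast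
    have "R v \<in> fin_fun Y" if "v \<in> fin_fun X" for v
    proof -
      have "supp (R v) \<subseteq> supp v \<inter> Y" unfolding supp_def R_def by auto
      then show ?thesis
        using that finite_subset[of "supp (R v)" "supp v"] unfolding fin_fun_def by blast
    qed
    then have "R ` B \<subseteq> fin_fun Y" using BV V(2) by blast
    then have "|R ` B| \<le>o fs.cdim (fin_fun Y :: ('i \<Rightarrow> 'f) set)"
      using fs.independent_le_cdim[OF subspace_fin_fun] ind by blast
    then have "|R ` B| \<le>o |Y|"
      using cdim_fin_fun ordLeq_ordIso_trans by blast
    moreover have "|B| =o |R ` B|"
      using inj_on_subset[OF inj BV] card_of_ordIso by (blast intro: bij_betw_imageI)
    ultimately have "|B| \<le>o |Y|" using ordIso_ordLeq_trans by blast
    then have "fs.cdim V \<le>o |Y|" using B(3) ordIso_symmetric ordIso_ordLeq_trans by blast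
    with Y show False using not_ordLess_ordLeq by blast
  qed
  then obtain v where "v \<in> V" "v \<noteq> 0" "R v = 0" by blast
  then show ?thesis
    using that[of v] by (auto simp: R_def supp_def fun_eq_iff split: if_splits)
qed

text \<open>The indicator of the \<open>i\<close> passing all membership tests;
  \<open>(l, c)\<close> asks that \<open>l \<in> s i\<close> have truth value
  \<open>c\<close>.\<close>

definition test :: "('i \<Rightarrow> 'l set) \<Rightarrow> ('l \<times> bool) list \<Rightarrow> 'i \<Rightarrow> 'f::field"
  where "test s ps i = (if \<forall>(l, c)\<in>set ps. (l \<in> s i) = c then 1 else 0)"

text \<open>Fix \<open>i0\<close> in the support and test at points where \<open>s i0\<close>
  differs from the other \<open>s i\<close>. Within the support only \<open>i0\<close> passes, and
  the sum reduces to \<open>v i0\<close>.\<close>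

lemma test_separates:
  fixes v :: "'i \<Rightarrow> 'f::field"
  assumes v: "v \<in> fin_fun X" "v \<noteq> 0" and s: "inj_on s X" "s ` X \<subseteq> Pow L"
  obtains ps where "set ps \<subseteq> L \<times> UNIV" "(\<Sum>i\<in>supp v. v i * test s ps i) \<noteq> 0"
proof -
  obtain i0 where i0: "i0 \<in> supp v" using v(2) by (auto simp: supp_def fun_eq_iff)
  have fin: "finite (supp v)" and suppX: "supp v \<subseteq> X" using v(1) unfolding fin_fun_def by auto
  have "\<exists>l\<in>L. (l \<in> s i) \<noteq> (l \<in> s i0)" if "i \<in> supp v - {i0}" for i
  proof -
    have "i \<in> X" "i0 \<in> X" "i \<noteq> i0" using that i0 suppX by auto
    then have "s i \<noteq> s i0" "s i \<subseteq> L" "s i0 \<subseteq> L" using s unfolding inj_on_def by auto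
    then show ?thesis by blast
  qed
  then obtain l where l: "\<And>i. i \<in> supp v - {i0} \<Longrightarrow> l i \<in> L \<and> (l i \<in> s i) \<noteq> (l i \<in> s i0)"
    by metis
  have "finite ((\<lambda>i. (l i, l i \<in> s i0)) ` (supp v - {i0}))" using fin by blast
  from finite_list[OF this] obtain ps where ps: "set ps = (\<lambda>i. (l i, l i \<in> s i0)) ` (supp v - {i0})" ..
  have "test s ps i = (if i = i0 then 1 else 0 :: 'f)" if "i \<in> supp v" for i
    using l[of i] that ps unfolding test_def by auto
  then have "(\<Sum>i\<in>supp v. v i * test s ps i) = (\<Sum>i\<in>supp v. if i = i0 then v i0 else 0)"
    by (intro sum.cong) auto
  also have "\<dots> = v i0" using fin i0 by simp
  finally have "(\<Sum>i\<in>supp v. v i * test s ps i) \<noteq> 0" using i0 unfolding supp_def by simp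
  moreover have "set ps \<subseteq> L \<times> UNIV" using ps l by auto
  ultimately show ?thesis using that by blast
qed

section \<open>The form with matrix \<open>C\<close>\<close>

definition form :: "('i \<Rightarrow> 'i \<Rightarrow> 'f) \<Rightarrow> ('i \<Rightarrow> 'f) \<Rightarrow> ('i \<Rightarrow> 'f) \<Rightarrow> 'f::field"
  where "form C v w = (\<Sum>i\<in>supp v. \<Sum>j\<in>supp w. v i * w j * C i j)"

text \<open>Supports change under addition and scaling; a common finite index set allows termwise
  comparison.\<close>

lemma form_superset:
  assumes "finite A" "supp v \<subseteq> A" "supp w \<subseteq> A"
  shows "form C v w = (\<Sum>i\<in>A. \<Sum>j\<in>A. v i * w j * C i j)"
proof -
  have "form C v w = (\<Sum>i\<in>supp v. \<Sum>j\<in>A. v i * w j * C i j)"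
    unfolding form_def using assms
    by (intro sum.cong sum.mono_neutral_left refl) (auto simp: supp_def)
  also have "\<dots> = (\<Sum>i\<in>A. \<Sum>j\<in>A. v i * w j * C i j)"
    using assms by (intro sum.mono_neutral_left) (auto simp: supp_def)
  finally show ?thesis .
qed

lemma form_bilinear:
  fixes C :: "'i \<Rightarrow> 'i \<Rightarrow> 'f::field"
  assumes C: "\<And>i j. C i j = C j i"
  shows "fs.symmetric_bilinear_form_on (fin_fun X) (form C)"
proof -
  have sym: "form C v w = form C w v" for v w
  proof -
    have "form C v w = (\<Sum>j\<in>supp w. \<Sum>i\<in>supp v. v i * w j * C i j)"
      unfolding form_def by (rule sum.swap)
    also have "\<dots> = form C w v"
      unfolding form_def by (intro sum.cong refl) (metis C mult.commute)
    finally show ?thesis .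
  qed
  have add: "form C (u + v) w = form C u w + form C v w"
    if "u \<in> fin_fun X" "v \<in> fin_fun X" "w \<in> fin_fun X" for u v w
  proof -
    let ?A = "supp u \<union> supp v \<union> supp w"
    have A: "finite ?A" using that unfolding fin_fun_def by auto
    have "form C (u + v) w = (\<Sum>i\<in>?A. \<Sum>j\<in>?A. (u + v) i * w j * C i j)"
      by (rule form_superset[OF A]) (use supp_add[of u v] in auto)
    moreover have "form C u w = (\<Sum>i\<in>?A. \<Sum>j\<in>?A. u i * w j * C i j)"
      "form C v w = (\<Sum>i\<in>?A. \<Sum>j\<in>?A. v i * w j * C i j)"
      by (rule form_superset[OF A]; auto)+
    ultimately show ?thesis by (simp add: algebra_simps sum.distrib)
  qed
  have scale: "form C (fscale c v) w = c * form C v w" if "v \<in> fin_fun X" "w \<in> fin_fun X" for c v w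
  proof -
    let ?A = "supp v \<union> supp w"
    have A: "finite ?A" using that unfolding fin_fun_def by auto
    have "form C (fscale c v) w = (\<Sum>i\<in>?A. \<Sum>j\<in>?A. fscale c v i * w j * C i j)"
      by (rule form_superset[OF A]) (use supp_fscale[of c v] in auto)
    moreover have "form C v w = (\<Sum>i\<in>?A. \<Sum>j\<in>?A. v i * w j * C i j)"
      by (rule form_superset[OF A]; auto)
    ultimately show ?thesis by (simp add: sum_distrib_left mult.assoc)
  qed
  have "form C w (u + v) = form C w u + form C w v" "form C w (fscale c v) = c * form C w v"
    if "u \<in> fin_fun X" "v \<in> fin_fun X" "w \<in> fin_fun X" for u v w c
    using add[OF that] scale[OF that(2,3)] by (simp_all add: sym[of w])
  with sym add scale show ?thesis
    unfolding fs.symmetric_bilinear_form_on_def by blast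
qed

section \<open>Subspaces of dimension above \<lambda> are never orthogonal\<close>

context succ_card
begin

lemma le_lists:
  assumes "|A| \<le>o |L|"
  shows "|{xs. set xs \<subseteq> A}| \<le>o |L|"
proof -
  have len: "|{xs. set xs \<subseteq> A \<and> length xs = n}| \<le>o |L|" for n
  proof (induction n)
    case 0
    have "{xs. set xs \<subseteq> A \<and> length xs = 0} = {[]}" by auto
    then show ?case using le_finite[of "{[]}"] by simp
  next
    case (Suc n)
    have "{xs. set xs \<subseteq> A \<and> length xs = Suc n} \<subseteq>
        (\<Union>x\<in>A. (\<lambda>xs. x # xs) ` {xs. set xs \<subseteq> A \<and> length xs = n})"
      by (auto simp: length_Suc_conv)
    moreover have "|\<Union>x\<in>A. (\<lambda>xs. x # xs) ` {xs. set xs \<subseteq> A \<and> length xs = n}| \<le>o |L|"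
      by (intro le_UN[OF assms] le_image Suc)
    ultimately show ?case using card_of_mono1 ordLeq_transitive by blast
  qed
  have "{xs. set xs \<subseteq> A} = (\<Union>n\<in>(UNIV::nat set). {xs. set xs \<subseteq> A \<and> length xs = n})" by auto
  moreover have "|\<Union>n\<in>(UNIV::nat set). {xs. set xs \<subseteq> A \<and> length xs = n}| \<le>o |L|"
    by (intro le_UN[OF le_countable] len)
  ultimately show ?thesis by simp
qed

lemma le_Times: "|A| \<le>o |L| \<Longrightarrow> |B| \<le>o |L| \<Longrightarrow> |A \<times> B| \<le>o |L|"
  using card_of_Sigma_ordLeq_infinite[OF infinite_L, of A "\<lambda>_. B"] by blast

text \<open>At most \<open>|L|\<close> points lie up to \<open>x\<close>, so some nonzero vector of
  \<open>V\<close> vanishes on them and has a separating list. As there are at most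
  \<open>|L|\<close> lists, one serves unboundedly many indices, and each \<open>x\<close> takes its
  vector from a later such index.\<close>

lemma uniform_vectors:
  fixes V :: "('i \<Rightarrow> 'f::field) set"
  assumes V: "fs.subspace V" "V \<subseteq> fin_fun X" "|L| <o fs.cdim V"
    and s: "inj_on s X" "s ` X \<subseteq> Pow L"
  obtains ps v where "set ps \<subseteq> L \<times> UNIV"
    "\<And>x. x \<in> X \<Longrightarrow> v x \<in> V \<and> (\<forall>i\<in>supp (v x). x \<prec> i) \<and> (\<Sum>i\<in>supp (v x). v x i * test s ps i) \<noteq> 0"
proof -
  define Q where "Q x v ps \<longleftrightarrow> v \<in> V \<and> (\<forall>i\<in>supp v. x \<prec> i) \<and> set ps \<subseteq> L \<times> UNIV \<and>
    (\<Sum>i\<in>supp v. v i * test s ps i) \<noteq> 0" for x v ps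
  have "\<exists>v ps. Q x v ps" if x: "x \<in> X" for x
  proof -
    let ?Y = "{y. y \<prec> x} \<union> {x}"
    have "|?Y| \<le>o |L|" by (intro le_Un X_seg[OF x] le_finite) simp
    then have "|?Y| <o fs.cdim V" using V(3) ordLeq_ordLess_trans by blast
    then obtain v where v: "v \<in> V" "v \<noteq> 0" "supp v \<inter> ?Y = {}"
      using vanishing_vector[OF V(1,2)] by blast
    obtain ps where ps: "set ps \<subseteq> L \<times> UNIV" "(\<Sum>i\<in>supp v. v i * test s ps i) \<noteq> 0"
      using test_separates[OF _ v(2) s] v(1) V(2) by blast
    have "x \<prec> i" if i: "i \<in> supp v" for i
    proof -
      have "i \<in> X" using v(1) V(2) i unfolding fin_fun_def by blast
      with total[of x i] x v(3) i show ?thesis by blast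
    qed
    with v ps show ?thesis unfolding Q_def by blast
  qed
  then obtain v ps where vp: "\<And>x. x \<in> X \<Longrightarrow> Q x (v x) (ps x)"
    by metis
  have "|L \<times> (UNIV::bool set)| \<le>o |L|"
    by (intro le_Times le_refl le_finite) simp
  moreover have "ps ` X \<subseteq> {xs. set xs \<subseteq> L \<times> UNIV}" using vp unfolding Q_def by blast
  ultimately have "|ps ` X| \<le>o |L|"
    by (rule_tac ordLeq_transitive[OF card_of_mono1 le_lists])
  then obtain p where p: "unbounded {x\<in>X. ps x = p}"
    using X_pigeonhole[OF X_unbounded] by blast
  then have "\<forall>x\<in>X. \<exists>y\<in>X. ps y = p \<and> x \<prec> y"
    unfolding unbounded_def by blast
  then obtain f where f: "\<And>x. x \<in> X \<Longrightarrow> f x \<in> X \<and> ps (f x) = p \<and> x \<prec> f x" by metis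
  show ?thesis
  proof (rule that[of p "\<lambda>x. v (f x)"])
    show "set p \<subseteq> L \<times> UNIV" using f vp X_nonempty unfolding Q_def by blast
    fix x assume "x \<in> X"
    with f[of x] vp[of "f x"] trans[of x "f x"]
    show "v (f x) \<in> V \<and> (\<forall>i\<in>supp (v (f x)). x \<prec> i) \<and> (\<Sum>i\<in>supp (v (f x)). v (f x) i * test s p i) \<noteq> 0"
      unfolding Q_def by blast
  qed
qed

text \<open>Once the colour is constantly \<open>(ps, qs)\<close> on the product of two supports,
  the form factors into the two nonzero sums of \<open>uniform_vectors\<close>.\<close>

lemma nonorthogonal_form:
  assumes p: "rich ({ps. set ps \<subseteq> L \<times> UNIV} \<times> {ps. set ps \<subseteq> L \<times> UNIV}) p"
    and s: "inj_on s X" "s ` X \<subseteq> Pow L"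
    and C: "\<And>i j. i \<prec> j \<Longrightarrow> C i j = test s (fst (p i j)) i * test s (snd (p i j)) j"
    and V: "fs.subspace V" "V \<subseteq> fin_fun X" "|L| <o fs.cdim V"
    and W: "fs.subspace W" "W \<subseteq> fin_fun X" "|L| <o fs.cdim W"
  shows "\<exists>v\<in>V. \<exists>w\<in>W. form C v w \<noteq> (0 :: 'f::field)"
proof -
  obtain ps v where v: "set ps \<subseteq> L \<times> UNIV"
    "\<And>x. x \<in> X \<Longrightarrow> v x \<in> V \<and> (\<forall>i\<in>supp (v x). x \<prec> i) \<and> (\<Sum>i\<in>supp (v x). v x i * test s ps i) \<noteq> 0"
    using uniform_vectors[OF V s] by blast
  obtain qs w where w: "set qs \<subseteq> L \<times> UNIV"
    "\<And>x. x \<in> X \<Longrightarrow> w x \<in> W \<and> (\<forall>i\<in>supp (w x). x \<prec> i) \<and> (\<Sum>i\<in>supp (w x). w x i * test s qs i) \<noteq> 0"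
    using uniform_vectors[OF W s] by blast
  have "\<forall>x\<in>X. finite (supp (v x)) \<and> finite (supp (w x)) \<and> (\<forall>i\<in>supp (v x) \<union> supp (w x). x \<prec> i)"
    using v(2) w(2) V(2) W(2) unfolding fin_fun_def by blast
  moreover have "(ps, qs) \<in> {ps. set ps \<subseteq> L \<times> UNIV} \<times> {ps. set ps \<subseteq> L \<times> UNIV}"
    using v(1) w(1) by simp
  ultimately obtain x y where xy: "x \<in> X" "y \<in> X"
    "\<forall>i\<in>supp (v x). \<forall>j\<in>supp (w y). i \<prec> j \<and> p i j = (ps, qs)"
    using p[unfolded rich_def, rule_format, of "(ps, qs)" "\<lambda>x. supp (v x)" "\<lambda>x. supp (w x)"] by blast
  have "form C (v x) (w y) = (\<Sum>i\<in>supp (v x). \<Sum>j\<in>supp (w y). (v x i * test s ps i) * (w y j * test s qs j))"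
    unfolding form_def using xy(3) C by (intro sum.cong refl) (auto simp: mult_ac)
  also have "\<dots> = (\<Sum>i\<in>supp (v x). v x i * test s ps i) * (\<Sum>j\<in>supp (w y). w y j * test s qs j)"
    by (simp add: sum_product)
  finally have "form C (v x) (w y) \<noteq> 0"
    using v(2)[OF xy(1)] w(2)[OF xy(2)] by simp
  with v(2)[OF xy(1)] w(2)[OF xy(2)] show ?thesis by blast
qed

end

text \<open>The field of \<open>cardSuc \<kappa>\<close> consists of elements of
  \<open>'k set\<close>, which is why the ambient vectors are functions on that type. If
  \<open>U\<close> has dimension at least \<kappa>^+ and its orthogonal space had full dimension,
  \<open>nonorthogonal_form\<close> would apply to the two.\<close>

theorem theorem3:
  fixes \<kappa> :: "'k rel"
  assumes "Card_order \<kappa>"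
    and "natLeq <o \<kappa>"
    and "regularCard \<kappa>"
  shows "\<exists>(scale :: 'f::field \<Rightarrow> ('k set \<Rightarrow> 'f) \<Rightarrow> ('k set \<Rightarrow> 'f)) E \<Phi>.
    gross_space scale (cardSuc \<kappa>) E \<Phi> \<and> vector_space.cdim scale E =o cardSuc \<kappa>"
proof -
  let ?X = "Field (cardSuc \<kappa>)" and ?L = "Field \<kappa>" and ?lt = "strict (cardSuc \<kappa>)"
  have suc: "Card_order (cardSuc \<kappa>)" by (rule cardSuc_Card_order[OF assms(1)])
  have L: "|?L| =o \<kappa>" and X: "|?X| =o cardSuc \<kappa>"
    using card_of_Field_ordIso assms(1) suc by blast+
  have inf: "infinite ?L"
    using ordLess_imp_ordLeq[OF ordLess_ordIso_trans[OF assms(2) ordIso_symmetric[OF L]]]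
    using infinite_iff_natLeq_ordLeq by blast
  have infX: "infinite ?X" using cardSuc_finite[OF assms(1)] inf by blast
  interpret S: succ_card ?X ?lt ?L "strict \<kappa>"
    by (rule cardSuc_succ_card[OF assms(1) inf assms(3)])
  let ?P = "{ps. set ps \<subseteq> ?L \<times> (UNIV::bool set)}"
  have "|?P \<times> ?P| \<le>o |?L|"
    by (intro S.le_Times S.le_lists S.le_refl S.le_finite) simp_all
  then obtain p where p: "S.rich (?P \<times> ?P) p"
    using rich_cardSuc[OF assms] by blast
  \<comment> \<open>Since \<kappa>^+ is at most the size of the power set, distinct indices can be
    given distinct subsets of \<open>?L\<close>.\<close>
  have "\<kappa> <o |Pow ?L|"
    using card_of_Pow[of ?L] L ordIso_symmetric ordIso_ordLess_trans by blast
  then have "cardSuc \<kappa> \<le>o |Pow ?L|"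
    using cardSuc_least[OF assms(1) card_of_Card_order] by blast
  then have "|?X| \<le>o |Pow ?L|" using X ordIso_ordLeq_trans by blast
  then obtain s where s: "inj_on s ?X" "s ` ?X \<subseteq> Pow ?L"
    using card_of_ordLeq[of ?X "Pow ?L"] by blast
  define C0 :: "'k set \<Rightarrow> 'k set \<Rightarrow> 'f" where "C0 i j = test s (fst (p i j)) i * test s (snd (p i j)) j" for i j
  \<comment> \<open>Symmetric extension from the pairs with the smaller index first; the diagonal is
    0.\<close>
  define C where "C i j = (if ?lt i j then C0 i j else if ?lt j i then C0 j i else 0)" for i j
  let ?E = "fin_fun ?X :: ('k set \<Rightarrow> 'f) set"
  have C_sym: "C i j = C j i" for i j
    unfolding C_def using S.asym[of i j] by auto
  have bil: "fs.symmetric_bilinear_form_on ?E (form C)"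
    by (rule form_bilinear[OF C_sym])
  have dimE: "fs.cdim ?E =o cardSuc \<kappa>"
    using cdim_fin_fun X ordIso_transitive by blast
  have large: "|?L| <o fs.cdim V" if "cardSuc \<kappa> \<le>o fs.cdim V" for V :: "('k set \<Rightarrow> 'f) set"
    using L cardSuc_greater[OF assms(1)] that ordIso_ordLess_trans ordLess_ordLeq_trans by blast
  have "gross_space fscale (cardSuc \<kappa>) ?E (form C)"
  proof unfold_locales
    show "Card_order (cardSuc \<kappa>)" by (rule suc)
    show "cinfinite (cardSuc \<kappa>)" unfolding cinfinite_def by (rule infX)
    show "fs.subspace ?E" by (rule subspace_fin_fun)
    show "fs.symmetric_bilinear_form_on ?E (form C)" by (rule bil)
    fix U :: "('k set \<Rightarrow> 'f) set"
    assume U: "fs.subspace U" "U \<subseteq> ?E" "cardSuc \<kappa> \<le>o fs.cdim U"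
    let ?W = "orthogonal_space ?E (form C) U"
    show "fs.cdim ?W <o fs.cdim ?E"
    proof (rule ccontr)
      assume "\<not> ?thesis"
      then have "fs.cdim ?E \<le>o fs.cdim ?W"
        unfolding fs.cdim_def using card_of_Well_order not_ordLess_iff_ordLeq by blast
      then have "cardSuc \<kappa> \<le>o fs.cdim ?W"
        using dimE ordIso_symmetric ordIso_ordLeq_trans by blast
      moreover have W: "fs.subspace ?W"
        unfolding fs.subspace_def orthogonal_space_def
      proof (intro conjI ballI allI)
        show "0 \<in> {x \<in> ?E. \<forall>y\<in>U. form C x y = 0}"
          using subspace_fin_fun[of ?X] by (auto simp: fs.subspace_def form_def supp_def)
        show "v + w \<in> {x \<in> ?E. \<forall>y\<in>U. form C x y = 0}"
          if "v \<in> {x \<in> ?E. \<forall>y\<in>U. form C x y = 0}" "w \<in> {x \<in> ?E. \<forall>y\<in>U. form C x y = 0}" for v w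
          using that U(2) bil subspace_fin_fun[of ?X]
          unfolding fs.symmetric_bilinear_form_on_def fs.subspace_def by (auto simp: subset_iff)
        show "fscale c v \<in> {x \<in> ?E. \<forall>y\<in>U. form C x y = 0}"
          if "v \<in> {x \<in> ?E. \<forall>y\<in>U. form C x y = 0}" for c v
          using that U(2) bil subspace_fin_fun[of ?X]
          unfolding fs.symmetric_bilinear_form_on_def fs.subspace_def by (auto simp: subset_iff)
      qed
      moreover have "?W \<subseteq> ?E" unfolding orthogonal_space_def by blast
      moreover have "C i j = test s (fst (p i j)) i * test s (snd (p i j)) j" if "?lt i j" for i j
        using that unfolding C_def C0_def by simp
      ultimately obtain w u where "w \<in> ?W" "u \<in> U" "form C w u \<noteq> 0"
        using S.nonorthogonal_form[OF p s, of C ?W U] U large by blast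
      then show False unfolding orthogonal_space_def by blast
    qed
  qed
  with dimE show ?thesis by blast
qed

end
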